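(* Let $p$ be an odd prime, $r$ a positive integer, and $a\in\mathbb{Z}$ with $\gcd(p,a)=1$. (1) If $\left(\frac{a}{p}\right)=1$, then the discriminant module of the even nondegenerate lattice with Gram matrix $\begin{pmatrix}2p^r & p^r\\ p^r & \frac12\left(p^r-\left(\frac{-1}{p}\right)^r\right)\end{pmatrix}$ is isometrically isomorphic to $\underline{A}_{p^r}^a$, and no even nondegenerate lattice of smaller rank has discriminant module isometrically isomorphic to $\underline{A}_{p^r}^a$. (2) If $\left(\frac{a}{p}\right)=-1$ and $r$ is even, choose an odd prime $q\ne p$ with $\left(\frac{q}{p}\right)=-1$ and an integer $v$ with $p^rv^2\equiv1\pmod q$ and $v^2\equiv1\pmod 4$. Then the discriminant module of the even nondegenerate lattice with Gram matrix $\begin{pmatrix}2qp^r & p^rv\\ p^rv & \frac{p^rv^2-1}{2q}\end{pmatrix}$ is isometrically isomorphic to $\underline{A}_{p^r}^a$, and no even nondegenerate lattice of smaller rank has this property. (3) If $\left(\frac{a}{p}\right)=-1$, $r$ is odd and $p\equiv3\pmod4$, then the discriminant module of the even nondegenerate lattice with Gram matrix $\begin{pmatrix}-2p^r & p^r\\ p^r & -\frac12(p^r+1)\end{pmatrix}$ is isometrically isomorphic to $\underline{A}_{p^r}^a$, and no even nondegenerate lattice of smaller rank has this property. (4) If $\left(\frac{a}{p}\right)=-1$, $r$ is odd and $p\equiv1\pmod4$, then there is no even nondegenerate lattice of rank $1$ or $2$ whose discriminant module is isometrically isomorphic to $\underline{A}_{p^r}^a$. Moreover, choose an odd prime $q$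 with $q\equiv2\pmod3$ and $\left(\frac{q}{p}\right)=-1$, let $v$ be an integer with $p^rv^2\equiv-\frac{4q+1}{3}\pmod q$ and $v^2\equiv-\frac{4q+1}{3}\pmod4$, and set $x=\frac{1}{4q}\left(p^rv^2+\frac{4q+1}{3}\right)$. Then the lattice with Gram matrix $\begin{pmatrix}2qp^r & p^rv & 0 & 0\\ p^rv & 2x & 1 & 0\\ 0&1&2&1\\0&0&1&2\end{pmatrix}$ is an even nondegenerate lattice of rank $4$ whose discriminant module is isometrically isomorphic to $\underline{A}_{p^r}^a$.
   Context: $\left(\frac{\cdot}{p}\right)$ denotes the Legendre symbol. A lattice $(L,B)$ is a free $\mathbb{Z}$-module $L$ of finite rank with a symmetric bilinear form $B\colon L\times L\to\mathbb{R}$; it is nondegenerate if its Gram matrix with respect to a basis has nonzero determinant, and even if $B(x,y)\in\mathbb{Z}$ for all $x,y$ and $B(x,x)\in2\mathbb{Z}$ for all $x$. The lattice with Gram matrix $G$ (a symmetric $n\times n$ real matrix) is $\mathbb{Z}^n$ with $B(x,y)=x^{\mathrm T}Gy$. The dual lattice is $L^\sharp=\{v\in\mathbb{R}\otimes L: B(v,w)\in\mathbb{Z}\ \forall w\in L\}$, and for even nondegenerate $L$ the discriminant module is $D_L=(L^\sharp/L,\ v+L\mapsto\frac12B(v,v)+\mathbb{Z})$. A finite quadratic module is a finite abelian group $M$ with $Q\colon M\to\mathbb{Q}/\mathbb{Z}$ such that $Q(nx)=n^2Q(x)$ and $B_Q(x,y)=Q(x+y)-Q(x)-Q(y)$ is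 bilinear and nondegenerate; an isometric isomorphism is a group isomorphism preserving $Q$. For an odd prime $p$, $r\ge1$, $p\nmid a$: $\underline{A}_{p^r}^a=(\mathbb{Z}/p^r\mathbb{Z},\ x+p^r\mathbb{Z}\mapsto\frac{a}{p^r}x^2+\mathbb{Z})$. *)

theory Defs
  imports
    "HOL-Analysis.Analysis"
    "HOL-Algebra.Elementary_Groups"
    "HOL-Number_Theory.Number_Theory"
    "HOL-Combinatorics.Permutations"
begin

text \<open>
  A lattice \<open>(L, B)\<close> is given inside a real vector space: \<open>L\<close> is the set of integral linear
  combinations of finitely many vectors that are linearly independent over the reals, so that
  \<open>span L\<close> is the real extension of the free \<open>\<int>\<close>-module \<open>L\<close>. Every free \<open>\<int>\<close>-module of finite rank
  arises in this way. The form \<open>B\<close> stands for the real bilinear extension of the form on \<open>L\<close>;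
  only its values on \<open>span L\<close> matter.
\<close>

definition int_basis :: "'v::real_vector set \<Rightarrow> 'v set \<Rightarrow> bool" where
  "int_basis b L \<longleftrightarrow> finite b \<and> independent b \<and>
     L = range (\<lambda>c :: 'v \<Rightarrow> int. \<Sum>x\<in>b. real_of_int (c x) *\<^sub>R x)"

definition int_lattice :: "'v::real_vector set \<Rightarrow> ('v \<Rightarrow> 'v \<Rightarrow> real) \<Rightarrow> bool" where
  "int_lattice L B \<longleftrightarrow> (\<exists>b. int_basis b L) \<and> bilinear B \<and> (\<forall>x y. B x y = B y x)"

definition lattice_rank :: "'v::real_vector set \<Rightarrow> nat" where
  "lattice_rank L = card (SOME b. int_basis b L)"

text \<open>Leibniz formula for the determinant of the Gram matrix \<open>(B x y)\<close> with \<open>x, y\<close> ranging over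
  the basis \<open>b\<close>.\<close>

definition gram_det :: "('v \<Rightarrow> 'v \<Rightarrow> real) \<Rightarrow> 'v set \<Rightarrow> real" where
  "gram_det B b = (\<Sum>\<pi> | \<pi> permutes b. of_int (sign \<pi>) * (\<Prod>x\<in>b. B x (\<pi> x)))"

definition nondegenerate_lattice :: "'v::real_vector set \<Rightarrow> ('v \<Rightarrow> 'v \<Rightarrow> real) \<Rightarrow> bool" where
  "nondegenerate_lattice L B \<longleftrightarrow> int_lattice L B \<and> (\<exists>b. int_basis b L \<and> gram_det B b \<noteq> 0)"

definition even_lattice :: "'v::real_vector set \<Rightarrow> ('v \<Rightarrow> 'v \<Rightarrow> real) \<Rightarrow> bool" where
  "even_lattice L B \<longleftrightarrow> int_lattice L B \<and>
     (\<forall>x\<in>L. \<forall>y\<in>L. B x y \<in> \<int>) \<and> (\<forall>x\<in>L. \<exists>k::int. B x x = 2 * of_int k)"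

definition std_lattice :: "(real ^ 'n) set" where
  "std_lattice = {x. \<forall>i. x $ i \<in> \<int>}"

definition gram_form :: "real ^ 'n ^ 'n \<Rightarrow> real ^ 'n \<Rightarrow> real ^ 'n \<Rightarrow> real" where
  "gram_form G x y = x \<bullet> (G *v y)"

definition dual_lattice :: "'v::real_vector set \<Rightarrow> ('v \<Rightarrow> 'v \<Rightarrow> real) \<Rightarrow> 'v set" where
  "dual_lattice L B = {v \<in> span L. \<forall>w\<in>L. B v w \<in> \<int>}"

text \<open>Elements of \<open>\<rat>/\<int>\<close> are represented as cosets of \<open>\<int>\<close> in the reals, that is, inside \<open>\<real>/\<int>\<close>.\<close>

definition mod_int :: "real \<Rightarrow> real set" where
  "mod_int t = {t + of_int k | k :: int. True}"

record 'a quadratic_module = "'a monoid" +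
  qform :: "'a \<Rightarrow> real set"

definition isometric ::
    "('a, 'c) quadratic_module_scheme \<Rightarrow> ('b, 'd) quadratic_module_scheme \<Rightarrow> bool" where
  "isometric M N \<longleftrightarrow> (\<exists>f \<in> iso M N. \<forall>x \<in> carrier M. qform N (f x) = qform M x)"

definition additive_group :: "'v::ab_group_add set \<Rightarrow> 'v monoid" where
  "additive_group S = \<lparr>carrier = S, monoid.mult = (+), one = 0\<rparr>"

text \<open>For an even lattice the class of \<open>B v v / 2\<close> does not depend on the representative \<open>v\<close> of the
  coset \<open>X\<close>, so the union below is a union of equal sets.\<close>

definition discriminant_module ::
    "'v::real_vector set \<Rightarrow> ('v \<Rightarrow> 'v \<Rightarrow> real) \<Rightarrow> 'v set quadratic_module" where
  "discriminant_module L B =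
     monoid.extend (additive_group (dual_lattice L B) Mod L)
       (quadratic_module.fields (\<lambda>X. \<Union>v\<in>X. mod_int (B v v / 2)))"

text \<open>The module \<open>A\<close> with subscript \<open>n\<close> and superscript \<open>a\<close>.\<close>

definition cyclic_qm :: "nat \<Rightarrow> int \<Rightarrow> int quadratic_module" where
  "cyclic_qm n a =
     monoid.extend (integer_mod_group n)
       (quadratic_module.fields (\<lambda>x. mod_int (of_int a / of_nat n * of_int x ^ 2)))"

end

theory Submission
  imports Defs
begin

text \<open>
  A generator of a cyclic discriminant module of order \<open>n\<close> is represented by a dual vector \<open>x\<close>, and
  the module is determined by \<open>B x x / 2\<close> modulo 1, up to squares of units. If the \<open>k\<close>-th row of an
  even Gram matrix of determinant \<open>n\<close> or \<open>- n\<close> is divisible by \<open>n\<close>, then the \<open>k\<close>-th unit vector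
  divided by \<open>n\<close> is such an \<open>x\<close>. For \<open>n = p\<^sup>r\<close> with an odd prime \<open>p\<close>, Hensel lifting reduces the
  comparison with the given module to Legendre symbols.

  A lattice of rank 1 generated by \<open>e\<close> is impossible because the class of \<open>e / 2\<close> would have order 2
  in a group of odd order. A lattice of rank 2 with cyclic discriminant module of order \<open>p\<^sup>r\<close> has
  a basis \<open>e, f\<close> such that \<open>e / p\<^sup>r\<close> generates the module. Its Gram matrix has the entries
  \<open>2 c p\<^sup>r\<close>, \<open>p\<^sup>r v\<close>, \<open>2 m\<close>, where \<open>p\<^sup>r v\<^sup>2 - 4 c m\<close> is 1 or -1, and is 1 if \<open>p\<close> is 1 modulo 4.
  Then \<open>c p\<^sup>r, p\<^sup>r v, m\<close> are the coefficients of a binary form of discriminant \<open>p\<^sup>r\<close>, and for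
  odd \<open>r\<close> quadratic reciprocity shows that \<open>m\<close>, and with it \<open>c\<close>, is a square modulo \<open>p\<close>.
\<close>

section \<open>Integral bases and dual lattices\<close>

lemma int_basis_sum_mem:
  fixes c :: "'v::real_vector \<Rightarrow> int"
  assumes "int_basis b L"
  shows "(\<Sum>z\<in>b. of_int (c z) *\<^sub>R z) \<in> L"
  using assms unfolding int_basis_def by blast

lemma int_basisE:
  fixes L :: "'v::real_vector set"
  assumes "int_basis b L" and "x \<in> L"
  obtains c :: "'v \<Rightarrow> int" where "x = (\<Sum>z\<in>b. of_int (c z) *\<^sub>R z)"
  using assms unfolding int_basis_def by blast

lemma int_basis_lincomb:
  assumes "int_basis b L" and "x \<in> L" and "y \<in> L"
  shows "of_int k *\<^sub>R x + of_int l *\<^sub>R y \<in> L"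
proof -
  from assms obtain c d :: "'a \<Rightarrow> int" where
    "x = (\<Sum>z\<in>b. of_int (c z) *\<^sub>R z)" "y = (\<Sum>z\<in>b. of_int (d z) *\<^sub>R z)"
    by (metis int_basisE)
  then have "of_int k *\<^sub>R x + of_int l *\<^sub>R y = (\<Sum>z\<in>b. of_int (k * c z + l * d z) *\<^sub>R z)"
    by (simp add: scaleR_sum_right sum.distrib scaleR_add_left)
  then show ?thesis using int_basis_sum_mem[OF assms(1)] by metis
qed

lemma int_basis_subset:
  assumes "int_basis b L"
  shows "b \<subseteq> L"
proof
  fix z assume "z \<in> b"
  then have "(\<Sum>x\<in>b. of_int (if x = z then 1 else 0) *\<^sub>R x) = z"
    using assms unfolding int_basis_def
    by (simp add: if_distrib[of real_of_int] if_distrib[of "\<lambda>t. t *\<^sub>R _"] cong: if_cong)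
  then show "z \<in> L"
    using int_basis_sum_mem[OF assms, of "\<lambda>x. if x = z then 1 else 0"] by simp
qed

lemma int_basis_span:
  assumes "int_basis b L"
  shows "span L = span b"
proof
  have "L \<subseteq> span b"
    using assms unfolding int_basis_def by (auto intro: span_sum span_scale span_base)
  then show "span L \<subseteq> span b" by (simp add: span_minimal subspace_span)
  show "span b \<subseteq> span L" by (rule span_mono[OF int_basis_subset[OF assms]])
qed

lemma lattice_rank_eq_card:
  assumes "int_basis b L"
  shows "lattice_rank L = card b"
proof -
  have "card b' = dim (span L)" if "int_basis b' L" for b'
    using that by (metis int_basis_span int_basis_def dim_span_eq_card_independent)
  then show ?thesis
    unfolding lattice_rank_def using assms by (metis someI)
qed

lemma linear_Ints_on_lattice:
  fixes f :: "'v::real_vector \<Rightarrow> real"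
  assumes "int_basis b L" and "linear f" and "\<And>w. w \<in> b \<Longrightarrow> f w \<in> \<int>" and "x \<in> L"
  shows "f x \<in> \<int>"
proof -
  obtain c :: "'v \<Rightarrow> int" where "x = (\<Sum>z\<in>b. of_int (c z) *\<^sub>R z)"
    using int_basisE assms(1,4) .
  then have "f x = (\<Sum>z\<in>b. of_int (c z) * f z)"
    by (simp add: linear_sum[OF assms(2)] linear_cmul[OF assms(2)])
  then show ?thesis using assms(3) by (simp add: Ints_sum)
qed

lemma mem_dual_lattice_iff:
  assumes "int_basis b L" and "bilinear B"
  shows "v \<in> dual_lattice L B \<longleftrightarrow> v \<in> span b \<and> (\<forall>w\<in>b. B v w \<in> \<int>)"
proof -
  have "linear (B v)" using assms(2) by (simp add: bilinear_def)
  then have "(\<forall>w\<in>L. B v w \<in> \<int>) \<longleftrightarrow> (\<forall>w\<in>b. B v w \<in> \<int>)"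
    using linear_Ints_on_lattice[OF assms(1)] int_basis_subset[OF assms(1)] by blast
  then show ?thesis
    unfolding dual_lattice_def int_basis_span[OF assms(1)] by blast
qed

lemma dual_lattice_add:
  assumes "bilinear B" and "x \<in> dual_lattice L B" and "y \<in> dual_lattice L B"
  shows "x + y \<in> dual_lattice L B"
  using assms unfolding dual_lattice_def by (auto simp: bilinear_ladd intro: span_add)

lemma dual_lattice_scale:
  assumes "bilinear B" and "x \<in> dual_lattice L B"
  shows "of_int m *\<^sub>R x \<in> dual_lattice L B"
  using assms unfolding dual_lattice_def by (auto simp: bilinear_lmul intro: span_scale)

lemma dual_lattice_uminus:
  assumes "bilinear B" and "x \<in> dual_lattice L B"
  shows "- x \<in> dual_lattice L B"
  using dual_lattice_scale[OF assms, of "- 1"] by simp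

section \<open>Even lattices\<close>

lemma half_norm_sum_Ints:
  fixes c :: "'v::real_vector \<Rightarrow> int" and B :: "'v \<Rightarrow> 'v \<Rightarrow> real"
  assumes bilinear: "bilinear B" and sym: "\<And>x y. B x y = B y x" and "finite b"
    and int: "\<And>x y. x \<in> b \<Longrightarrow> y \<in> b \<Longrightarrow> B x y \<in> \<int>"
    and half: "\<And>x. x \<in> b \<Longrightarrow> B x x / 2 \<in> \<int>"
  shows "B (\<Sum>z\<in>b. of_int (c z) *\<^sub>R z) (\<Sum>z\<in>b. of_int (c z) *\<^sub>R z) / 2 \<in> \<int>"
  using assms(3-5)
proof (induction b rule: finite_induct)
  case empty
  then show ?case by (simp add: bilinear_lzero[OF bilinear])
next
  case (insert z b)
  define s where "s = (\<Sum>z\<in>b. of_int (c z) *\<^sub>R z)"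
  have linear: "linear (B z)" using bilinear by (simp add: bilinear_def)
  have "B z s \<in> \<int>"
    unfolding s_def using insert.prems(1)
    by (auto simp: linear_sum[OF linear] linear_cmul[OF linear])
  moreover have "B z z / 2 \<in> \<int>" "B s s / 2 \<in> \<int>"
    using insert unfolding s_def by auto
  moreover have "B (of_int (c z) *\<^sub>R z + s) (of_int (c z) *\<^sub>R z + s) / 2
      = of_int (c z ^ 2) * (B z z / 2) + of_int (c z) * B z s + B s s / 2"
    by (simp add: bilinear_ladd[OF bilinear] bilinear_radd[OF bilinear] bilinear_lmul[OF bilinear]
        bilinear_rmul[OF bilinear] sym[of s z] power2_eq_square field_simps)
  ultimately have "B (of_int (c z) *\<^sub>R z + s) (of_int (c z) *\<^sub>R z + s) / 2 \<in> \<int>"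
    by (metis Ints_add Ints_mult Ints_of_int)
  then show ?case
    unfolding s_def using insert.hyps by simp
qed

lemma even_latticeI:
  fixes L :: "'v::real_vector set"
  assumes basis: "int_basis b L" and bilinear: "bilinear B" and sym: "\<And>x y. B x y = B y x"
    and int: "\<And>x y. x \<in> b \<Longrightarrow> y \<in> b \<Longrightarrow> B x y \<in> \<int>"
    and half: "\<And>x. x \<in> b \<Longrightarrow> B x x / 2 \<in> \<int>"
  shows "even_lattice L B"
proof -
  have linear: "linear (B x)" "linear (\<lambda>x. B x y)" for x y
    using bilinear by (simp_all add: bilinear_def)
  have int_right: "B x y \<in> \<int>" if "x \<in> b" "y \<in> L" for x y
    using linear_Ints_on_lattice[OF basis linear(1) int] that by blast
  have int_lattice: "B x y \<in> \<int>" if "x \<in> L" "y \<in> L" for x y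
    using linear_Ints_on_lattice[OF basis linear(2) int_right] that by blast
  have "\<exists>k::int. B x x = 2 * of_int k" if "x \<in> L" for x
  proof -
    have "B x x / 2 \<in> \<int>"
      using that half_norm_sum_Ints[OF bilinear sym _ int half] basis unfolding int_basis_def
      by auto
    then obtain k :: int where "B x x / 2 = of_int k" by (rule Ints_cases)
    then have "B x x = 2 * of_int k" by simp
    then show ?thesis by blast
  qed
  then show ?thesis
    unfolding even_lattice_def int_lattice_def using basis bilinear sym int_lattice by blast
qed

lemma even_lattice_basis:
  assumes "even_lattice L B"
  obtains b where "int_basis b L"
  using assms unfolding even_lattice_def int_lattice_def by auto

context
  fixes L :: "'v::real_vector set" and B :: "'v \<Rightarrow> 'v \<Rightarrow> real"
  assumes even: "even_lattice L B"
begin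

lemma even_lattice_bilinear: "bilinear B" and even_lattice_sym: "B x y = B y x"
  using even unfolding even_lattice_def int_lattice_def by auto

lemmas even_lattice_form_simps =
  bilinear_ladd[OF even_lattice_bilinear] bilinear_radd[OF even_lattice_bilinear]
  bilinear_lmul[OF even_lattice_bilinear] bilinear_rmul[OF even_lattice_bilinear]

lemma even_lattice_lincomb:
  "x \<in> L \<Longrightarrow> y \<in> L \<Longrightarrow> of_int k *\<^sub>R x + of_int l *\<^sub>R y \<in> L"
  by (metis even_lattice_basis[OF even] int_basis_lincomb)

lemma even_lattice_zero: "0 \<in> L"
proof -
  obtain b where "int_basis b L" using even_lattice_basis[OF even] .
  from int_basis_sum_mem[OF this, of "\<lambda>_. 0"] show ?thesis by simp
qed

lemma even_lattice_closed:
  assumes "x \<in> L"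
  shows "y \<in> L \<Longrightarrow> x + y \<in> L" "y \<in> L \<Longrightarrow> x - y \<in> L" "- x \<in> L" "of_int k *\<^sub>R x \<in> L"
  using even_lattice_lincomb[OF assms, of y 1 1] even_lattice_lincomb[OF assms, of y 1 "- 1"]
    even_lattice_lincomb[OF assms assms, of "- 1" 0] even_lattice_lincomb[OF assms assms, of k 0]
  by simp_all

lemma even_lattice_Ints: "x \<in> L \<Longrightarrow> y \<in> L \<Longrightarrow> B x y \<in> \<int>"
  using even unfolding even_lattice_def by blast

lemma even_lattice_half_norm: "x \<in> L \<Longrightarrow> B x x / 2 \<in> \<int>"
  using even unfolding even_lattice_def by fastforce

lemma even_lattice_subset_dual: "x \<in> L \<Longrightarrow> x \<in> dual_lattice L B"
  unfolding dual_lattice_def by (auto intro: span_base even_lattice_Ints)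

lemma half_norm_diff_Ints:
  assumes "x \<in> dual_lattice L B" and "y - x \<in> L"
  shows "B y y / 2 - B x x / 2 \<in> \<int>"
proof -
  define h where "h = y - x"
  have "B h h / 2 \<in> \<int>" "B x h \<in> \<int>"
    using assms even_lattice_half_norm unfolding h_def dual_lattice_def by auto
  moreover have "B (x + h) (x + h) / 2 - B x x / 2 = B h h / 2 + B x h"
    using even_lattice_sym[of x h] by (simp add: even_lattice_form_simps field_simps)
  ultimately show ?thesis unfolding h_def by simp
qed

end

section \<open>Cyclic discriminant modules\<close>

lemma mod_int_eq_iff: "mod_int s = mod_int t \<longleftrightarrow> s - t \<in> \<int>"
proof
  assume "mod_int s = mod_int t"
  moreover have "s \<in> mod_int s" unfolding mod_int_def by (auto intro: exI[of _ 0])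
  ultimately obtain k :: int where "s = t + of_int k" unfolding mod_int_def by auto
  then show "s - t \<in> \<int>" by simp
next
  have mod_int_mono: "mod_int s \<subseteq> mod_int t" if diff_Ints: "s - t \<in> \<int>" for s t
  proof
    fix z assume "z \<in> mod_int s"
    then obtain j :: int where "z = s + of_int j" unfolding mod_int_def by blast
    moreover obtain k :: int where "s - t = of_int k" using diff_Ints by (rule Ints_cases)
    ultimately have "z = t + of_int (k + j)" by simp
    then show "z \<in> mod_int t" unfolding mod_int_def by blast
  qed
  assume "s - t \<in> \<int>"
  moreover from this have "t - s \<in> \<int>" using Ints_minus by fastforce
  ultimately show "mod_int s = mod_int t" using mod_int_mono by blast
qed

lemma cong_imp_cyclic_form_diff_Ints:
  fixes a k l :: int and n :: nat
  assumes "[k = l] (mod int n)"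
  shows "of_int a / of_nat n * of_int k ^ 2 - of_int a / of_nat n * of_int l ^ 2 \<in> (\<int> :: real set)"
proof (cases "n = 0")
  case False
  obtain j where "k = l + int n * j"
    using cong_sym[OF assms] unfolding cong_iff_lin by blast
  then have "of_int a / of_nat n * of_int k ^ 2 - of_int a / of_nat n * of_int l ^ 2
      = real_of_int (a * (2 * l * j + int n * j ^ 2))"
    using False by (simp add: field_simps power2_eq_square)
  then show ?thesis by (metis Ints_of_int)
qed simp

definition discriminant_generator ::
    "'v::real_vector set \<Rightarrow> ('v \<Rightarrow> 'v \<Rightarrow> real) \<Rightarrow> nat \<Rightarrow> 'v \<Rightarrow> bool" where
  "discriminant_generator L B n x \<longleftrightarrow> x \<in> dual_lattice L B \<and>
     (\<forall>m::int. of_int m *\<^sub>R x \<in> L \<longleftrightarrow> int n dvd m) \<and>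
     (\<forall>y\<in>dual_lattice L B. \<exists>m::int. y - of_int m *\<^sub>R x \<in> L)"

abbreviation (input) dual_group :: "'v::real_vector set \<Rightarrow> ('v \<Rightarrow> 'v \<Rightarrow> real) \<Rightarrow> 'v monoid" where
  "dual_group L B \<equiv> additive_group (dual_lattice L B)"

abbreviation (input) lattice_coset ::
    "'v::real_vector set \<Rightarrow> ('v \<Rightarrow> 'v \<Rightarrow> real) \<Rightarrow> 'v \<Rightarrow> 'v set" where
  "lattice_coset L B x \<equiv> L #>\<^bsub>dual_group L B\<^esub> x"

lemma carrier_dual_group_Mod:
  "carrier (dual_group L B Mod L) = lattice_coset L B ` dual_lattice L B"
  by (simp add: carrier_FactGroup additive_group_def)

lemma iso_discriminant_module_cyclic_qm:
  "iso (discriminant_module L B) (cyclic_qm n a) = iso (dual_group L B Mod L) (integer_mod_group n)"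
  by (simp add: iso_def hom_def discriminant_module_def cyclic_qm_def monoid.defs)

context
  fixes L :: "'v::real_vector set" and B :: "'v \<Rightarrow> 'v \<Rightarrow> real"
  assumes even: "even_lattice L B"
begin

lemma comm_group_dual_group: "comm_group (dual_group L B)"
proof (rule comm_groupI)
  fix x assume "x \<in> carrier (dual_group L B)"
  then show "\<exists>y\<in>carrier (dual_group L B). y \<otimes>\<^bsub>dual_group L B\<^esub> x = \<one>\<^bsub>dual_group L B\<^esub>"
    using dual_lattice_uminus[OF even_lattice_bilinear[OF even]] unfolding additive_group_def
    by (auto intro: bexI[of _ "- x"])
qed (use even_lattice_zero[OF even] in \<open>auto simp: additive_group_def ac_simps
      intro: dual_lattice_add[OF even_lattice_bilinear[OF even]] even_lattice_subset_dual[OF even]\<close>)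

lemma group_dual_group: "group (dual_group L B)"
  using comm_group_dual_group by (rule comm_group.axioms(2))

lemma inv_dual_group:
  assumes "x \<in> dual_lattice L B"
  shows "inv\<^bsub>dual_group L B\<^esub> x = - x"
  using group.inv_equality[OF group_dual_group, of "- x" x] assms
    dual_lattice_uminus[OF even_lattice_bilinear[OF even] assms]
  by (simp add: additive_group_def)

lemma int_pow_dual_group:
  assumes "x \<in> dual_lattice L B"
  shows "x [^]\<^bsub>dual_group L B\<^esub> (m::int) = of_int m *\<^sub>R x"
proof -
  have nat_pow: "x [^]\<^bsub>dual_group L B\<^esub> k = of_nat k *\<^sub>R x" for k :: nat
    by (induction k) (simp_all add: additive_group_def nat_pow_def algebra_simps)
  show ?thesis
    using dual_lattice_scale[OF even_lattice_bilinear[OF even] assms, of "- m"]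
    by (simp add: int_pow_def2 nat_pow inv_dual_group)
qed

lemma normal_dual_group: "L \<lhd> dual_group L B"
proof -
  have "subgroup L (dual_group L B)"
  proof (rule group.subgroupI[OF group_dual_group])
    show "inv\<^bsub>dual_group L B\<^esub> x \<in> L" if "x \<in> L" for x
      using that even_lattice_closed(3)[OF even] even_lattice_subset_dual[OF even]
      by (simp add: inv_dual_group)
  qed (use even_lattice_zero[OF even] even_lattice_closed(1)[OF even]
        even_lattice_subset_dual[OF even] in \<open>auto simp: additive_group_def\<close>)
  then show ?thesis by (simp add: comm_group.normal_iff_subgroup[OF comm_group_dual_group])
qed

lemma lattice_coset_eq_iff:
  assumes "x \<in> dual_lattice L B" and "y \<in> dual_lattice L B"
  shows "lattice_coset L B x = lattice_coset L B y \<longleftrightarrow> x - y \<in> L"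
proof -
  have carrier: "x \<in> carrier (dual_group L B)" "y \<in> carrier (dual_group L B)"
    using assms by (simp_all add: additive_group_def)
  note subgroup = normal_imp_subgroup[OF normal_dual_group]
  have "lattice_coset L B x = lattice_coset L B y \<longleftrightarrow> x \<in> lattice_coset L B y"
    using group.repr_independence[OF group_dual_group _ carrier(2) subgroup]
      group.rcos_self[OF group_dual_group carrier(1) subgroup] by metis
  also have "\<dots> \<longleftrightarrow> x - y \<in> L"
    using subgroup.rcos_module[OF subgroup group_dual_group carrier(2,1)] inv_dual_group[OF assms(2)]
    by (simp add: additive_group_def)
  finally show ?thesis .
qed

lemma qform_discriminant_module:
  assumes "x \<in> dual_lattice L B"
  shows "qform (discriminant_module L B) (lattice_coset L B x) = mod_int (B x x / 2)"
proof -
  have coset: "lattice_coset L B x = {h + x | h. h \<in> L}"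
    by (auto simp: r_coset_def additive_group_def)
  have "mod_int (B v v / 2) = mod_int (B x x / 2)" if "v \<in> lattice_coset L B x" for v
    using that half_norm_diff_Ints[OF even assms, of v] by (auto simp: coset mod_int_eq_iff)
  moreover have "x \<in> lattice_coset L B x" using even_lattice_zero[OF even] by (force simp: coset)
  ultimately have "(\<Union>v\<in>lattice_coset L B x. mod_int (B v v / 2)) = mod_int (B x x / 2)"
    by blast
  then show ?thesis
    unfolding discriminant_module_def by (simp add: monoid.defs quadratic_module.defs)
qed

lemma isometric_cyclic_qm_iff_iso:
  "isometric (discriminant_module L B) (cyclic_qm n a) \<longleftrightarrow>
    (\<exists>f\<in>iso (dual_group L B Mod L) (integer_mod_group n). \<forall>x\<in>dual_lattice L B.
       B x x / 2 - of_int a / of_nat n * of_int (f (lattice_coset L B x)) ^ 2 \<in> \<int>)"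
proof -
  have carrier: "carrier (discriminant_module L B) = lattice_coset L B ` dual_lattice L B"
    by (simp add: discriminant_module_def monoid.defs carrier_dual_group_Mod)
  have "qform (cyclic_qm n a) k = qform (discriminant_module L B) (lattice_coset L B x) \<longleftrightarrow>
      B x x / 2 - of_int a / of_nat n * of_int k ^ 2 \<in> \<int>"
    if "x \<in> dual_lattice L B" for x k
    unfolding qform_discriminant_module[OF that]
    by (auto simp: cyclic_qm_def monoid.defs quadratic_module.defs simp flip: mod_int_eq_iff)
  then show ?thesis
    unfolding isometric_def iso_discriminant_module_cyclic_qm carrier by simp
qed

lemma int_pow_lattice_coset:
  assumes "x \<in> dual_lattice L B"
  shows "lattice_coset L B x [^]\<^bsub>dual_group L B Mod L\<^esub> (m::int) =
    lattice_coset L B (of_int m *\<^sub>R x)"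
  using normal.FactGroup_int_pow[OF normal_dual_group, of x m] int_pow_dual_group[OF assms] assms
  by (simp add: additive_group_def)

lemma iso_integer_mod_group_imp_generator:
  assumes n_pos: "n > 0" and f_iso: "f \<in> iso (dual_group L B Mod L) (integer_mod_group n)"
  obtains x where "discriminant_generator L B n x" and "f (lattice_coset L B x) = 1 mod int n"
proof -
  let ?Q = "dual_group L B Mod L" and ?D = "dual_lattice L B"
  note carrier = carrier_dual_group_Mod[of L B]
  have groups: "group ?Q" "group (integer_mod_group n)"
    by (simp_all add: normal.factorgroup_is_group[OF normal_dual_group])
  have hom: "f \<in> hom ?Q (integer_mod_group n)"
    and inj: "inj_on f (carrier ?Q)" and surj: "f ` carrier ?Q = {0..<int n}"
    using f_iso n_pos by (auto simp: iso_def bij_betw_def carrier_integer_mod_group)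
  have "1 mod int n \<in> f ` carrier ?Q" using n_pos unfolding surj by simp
  then obtain x where x_dual: "x \<in> ?D" and f_x: "f (lattice_coset L B x) = 1 mod int n"
    unfolding carrier by auto
  have multiple_dual: "of_int m *\<^sub>R x \<in> ?D" for m
    by (rule dual_lattice_scale[OF even_lattice_bilinear[OF even] x_dual])
  have f_multiple: "f (lattice_coset L B (of_int m *\<^sub>R x)) = m mod int n" for m
    using hom_int_pow[OF hom _ groups, of "lattice_coset L B x" m] x_dual f_x carrier
    by (simp add: int_pow_lattice_coset int_pow_integer_mod_group mod_mult_right_eq)
  have f_eq_iff: "f (lattice_coset L B y) = f (lattice_coset L B z) \<longleftrightarrow> y - z \<in> L"
    if "y \<in> ?D" "z \<in> ?D" for y z
    using inj_on_eq_iff[OF inj] lattice_coset_eq_iff[OF that] that by (simp add: carrier)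
  have "of_int m *\<^sub>R x \<in> L \<longleftrightarrow> int n dvd m" for m
    using f_eq_iff[OF multiple_dual[of m] multiple_dual[of 0]]
    by (simp only: f_multiple) (simp add: mod_eq_0_iff_dvd)
  moreover have "\<exists>m::int. y - of_int m *\<^sub>R x \<in> L" if y_dual: "y \<in> ?D" for y
  proof
    have "f (lattice_coset L B y) \<in> {0..<int n}" using y_dual surj carrier by blast
    then show "y - of_int (f (lattice_coset L B y)) *\<^sub>R x \<in> L"
      by (simp add: f_multiple flip: f_eq_iff[OF y_dual multiple_dual])
  qed
  ultimately have "discriminant_generator L B n x"
    using x_dual unfolding discriminant_generator_def by blast
  with f_x that show ?thesis by blast
qed

lemma generator_multiples_iso:
  assumes n_pos: "n > 0" and generator: "discriminant_generator L B n x"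
  shows "(\<lambda>k. lattice_coset L B (of_int k *\<^sub>R x))
    \<in> iso (integer_mod_group n) (dual_group L B Mod L)"
proof -
  let ?Q = "dual_group L B Mod L" and ?g = "\<lambda>k::int. lattice_coset L B (of_int k *\<^sub>R x)"
  note carrier = carrier_dual_group_Mod[of L B]
  have multiple: "of_int k *\<^sub>R x \<in> dual_lattice L B" for k
    using generator dual_lattice_scale[OF even_lattice_bilinear[OF even]]
    unfolding discriminant_generator_def by blast
  have eq_iff: "?g k = ?g l \<longleftrightarrow> [k = l] (mod int n)" for k l
    using generator lattice_coset_eq_iff[OF multiple multiple, of k l]
    unfolding discriminant_generator_def
    by (simp add: cong_iff_dvd_diff flip: scaleR_diff_left of_int_diff)
  have reduce: "?g (k mod int n) = ?g k" for k by (simp add: eq_iff)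
  have add: "?g (k + l) = ?g k \<otimes>\<^bsub>?Q\<^esub> ?g l" for k l
    using normal.rcos_sum[OF normal_dual_group, of "of_int k *\<^sub>R x" "of_int l *\<^sub>R x"] multiple
    by (simp add: additive_group_def scaleR_add_left)
  have onto: "lattice_coset L B y \<in> ?g ` {0..<int n}" if y_dual: "y \<in> dual_lattice L B" for y
  proof -
    obtain m :: int where "y - of_int m *\<^sub>R x \<in> L"
      using generator y_dual unfolding discriminant_generator_def by blast
    then have "lattice_coset L B y = ?g (m mod int n)"
      unfolding reduce using lattice_coset_eq_iff[OF y_dual multiple] by blast
    then show ?thesis by (rule image_eqI) (use n_pos in simp)
  qed
  show ?thesis
  proof (rule isoI)
    show "?g \<in> hom (integer_mod_group n) ?Q"
    proof (rule homI)
      show "?g k \<in> carrier ?Q" for k using multiple by (simp add: carrier)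
    qed (simp only: mult_integer_mod_group reduce add)
    have "inj_on ?g {0..<int n}" unfolding inj_on_def eq_iff by (simp add: cong_def)
    moreover have "?g ` {0..<int n} = carrier ?Q"
      unfolding carrier using onto multiple by blast
    ultimately show "bij_betw ?g (carrier (integer_mod_group n)) (carrier ?Q)"
      using n_pos by (simp add: bij_betw_def carrier_integer_mod_group)
  qed
qed

lemma generator_imp_iso_integer_mod_group:
  assumes n_pos: "n > 0" and generator: "discriminant_generator L B n x"
  obtains f where "f \<in> iso (dual_group L B Mod L) (integer_mod_group n)"
    and "\<And>y. y \<in> dual_lattice L B \<Longrightarrow> y - of_int (f (lattice_coset L B y)) *\<^sub>R x \<in> L"
proof
  let ?g = "\<lambda>k::int. lattice_coset L B (of_int k *\<^sub>R x)"
  let ?f = "inv_into (carrier (integer_mod_group n)) ?g"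
  note iso = generator_multiples_iso[OF assms]
  show "?f \<in> iso (dual_group L B Mod L) (integer_mod_group n)"
    by (rule group.iso_set_sym[OF group_integer_mod_group iso])
  fix y assume y_dual: "y \<in> dual_lattice L B"
  then have "lattice_coset L B y \<in> ?g ` carrier (integer_mod_group n)"
    using iso by (simp add: iso_def bij_betw_def carrier_dual_group_Mod)
  then have "lattice_coset L B y = ?g (?f (lattice_coset L B y))" by (rule f_inv_into_f[symmetric])
  moreover have "of_int (?f (lattice_coset L B y)) *\<^sub>R x \<in> dual_lattice L B"
    using generator dual_lattice_scale[OF even_lattice_bilinear[OF even]]
    unfolding discriminant_generator_def by blast
  ultimately show "y - of_int (?f (lattice_coset L B y)) *\<^sub>R x \<in> L"
    using lattice_coset_eq_iff[OF y_dual] by blast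
qed

lemma generator_half_norm:
  fixes a m :: int and n :: nat
  assumes "x \<in> dual_lattice L B" and "B x x / 2 - of_int a / of_nat n \<in> \<int>"
    and "y - of_int m *\<^sub>R x \<in> L"
  shows "B y y / 2 - of_int a / of_nat n * of_int m ^ 2 \<in> \<int>"
proof -
  let ?mx = "of_int m *\<^sub>R x"
  have "B y y / 2 - B ?mx ?mx / 2 \<in> \<int>"
    by (intro half_norm_diff_Ints[OF even] assms(3)
        dual_lattice_scale[OF even_lattice_bilinear[OF even] assms(1)])
  moreover have "of_int (m ^ 2) * (B x x / 2 - of_int a / of_nat n) \<in> \<int>"
    by (rule Ints_mult[OF Ints_of_int assms(2)])
  moreover have "B y y / 2 - of_int a / of_nat n * of_int m ^ 2
      = (B y y / 2 - B ?mx ?mx / 2) + of_int (m ^ 2) * (B x x / 2 - of_int a / of_nat n)"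
    by (simp add: even_lattice_form_simps[OF even] power2_eq_square algebra_simps)
  ultimately show ?thesis by (simp only: Ints_add)
qed

lemma isometric_cyclic_qm_iff:
  assumes n_pos: "n > 0"
  shows "isometric (discriminant_module L B) (cyclic_qm n a) \<longleftrightarrow>
    (\<exists>x. discriminant_generator L B n x \<and> B x x / 2 - of_int a / of_nat n \<in> \<int>)"
proof
  assume "isometric (discriminant_module L B) (cyclic_qm n a)"
  then obtain f where f_iso: "f \<in> iso (dual_group L B Mod L) (integer_mod_group n)"
    and f_form: "\<And>x. x \<in> dual_lattice L B \<Longrightarrow>
      B x x / 2 - of_int a / of_nat n * of_int (f (lattice_coset L B x)) ^ 2 \<in> \<int>"
    unfolding isometric_cyclic_qm_iff_iso by blast
  obtain x where generator: "discriminant_generator L B n x"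
    and f_x: "f (lattice_coset L B x) = 1 mod int n"
    using iso_integer_mod_group_imp_generator[OF n_pos f_iso] .
  have "B x x / 2 - of_int a / of_nat n * of_int (1 mod int n) ^ 2 \<in> \<int>"
    using f_form[of x] generator f_x unfolding discriminant_generator_def by simp
  from Ints_add[OF this cong_imp_cyclic_form_diff_Ints[of "1 mod int n" 1 n a]]
  show "\<exists>x. discriminant_generator L B n x \<and> B x x / 2 - of_int a / of_nat n \<in> \<int>"
    using generator by auto
next
  assume "\<exists>x. discriminant_generator L B n x \<and> B x x / 2 - of_int a / of_nat n \<in> \<int>"
  then obtain x where generator: "discriminant_generator L B n x"
    and half_norm: "B x x / 2 - of_int a / of_nat n \<in> \<int>"
    by blast
  obtain f where "f \<in> iso (dual_group L B Mod L) (integer_mod_group n)"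
    and "\<And>y. y \<in> dual_lattice L B \<Longrightarrow> y - of_int (f (lattice_coset L B y)) *\<^sub>R x \<in> L"
    using generator_imp_iso_integer_mod_group[OF n_pos generator] by metis
  then show "isometric (discriminant_module L B) (cyclic_qm n a)"
    unfolding isometric_cyclic_qm_iff_iso
    using generator_half_norm[OF _ half_norm] generator unfolding discriminant_generator_def
    by blast
qed

lemma discriminant_generator_unit_multiple:
  assumes generator: "discriminant_generator L B n x" and coprime: "coprime u (int n)"
    and y_mod_L: "y - of_int u *\<^sub>R x \<in> L"
  shows "discriminant_generator L B n y"
proof -
  define h where "h = y - of_int u *\<^sub>R x"
  have h_mem: "h \<in> L" and y_eq: "y = of_int u *\<^sub>R x + h" using y_mod_L unfolding h_def by simp_all
  have x_dual: "x \<in> dual_lattice L B" using generator unfolding discriminant_generator_def by blast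
  note bilinear = even_lattice_bilinear[OF even]
  have "y \<in> dual_lattice L B"
    unfolding y_eq
    by (rule dual_lattice_add[OF bilinear dual_lattice_scale[OF bilinear x_dual]
          even_lattice_subset_dual[OF even h_mem]])
  moreover have "of_int m *\<^sub>R y \<in> L \<longleftrightarrow> int n dvd m" for m
  proof -
    have y_multiple: "of_int m *\<^sub>R y = of_int (m * u) *\<^sub>R x + of_int m *\<^sub>R h"
      unfolding y_eq by (simp add: algebra_simps)
    have "of_int m *\<^sub>R y \<in> L \<longleftrightarrow> of_int (m * u) *\<^sub>R x \<in> L"
      using even_lattice_closed(1,2)[OF even _ even_lattice_closed(4)[OF even h_mem, of m]]
      unfolding y_multiple by fastforce
    also have "\<dots> \<longleftrightarrow> int n dvd m * u" using generator unfolding discriminant_generator_def by blast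
    finally show ?thesis using coprime by (simp add: coprime_dvd_mult_left_iff coprime_commute)
  qed
  moreover have "\<exists>m::int. z - of_int m *\<^sub>R y \<in> L" if z_dual: "z \<in> dual_lattice L B" for z
  proof -
    obtain k :: int where z_mod_L: "z - of_int k *\<^sub>R x \<in> L"
      using generator z_dual unfolding discriminant_generator_def by blast
    obtain u' where "[u * u' = 1] (mod int n)" using coprime cong_solve_coprime_int by blast
    then have "[k * (u * u') = k * 1] (mod int n)" by (rule cong_scalar_left)
    then have "int n dvd k - k * u' * u"
      by (simp add: cong_iff_dvd_diff dvd_diff_commute ac_simps)
    then have "of_int (k - k * u' * u) *\<^sub>R x \<in> L"
      using generator unfolding discriminant_generator_def by blast
    from even_lattice_closed(2)[OF even even_lattice_closed(1)[OF even z_mod_L this]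
        even_lattice_closed(4)[OF even h_mem, of "k * u'"]]
    have "z - of_int (k * u') *\<^sub>R y \<in> L" unfolding y_eq by (simp add: algebra_simps)
    then show ?thesis by blast
  qed
  ultimately show ?thesis unfolding discriminant_generator_def by blast
qed

lemma isometric_cyclic_qm_square_multiple:
  fixes a c u :: int
  assumes n_pos: "n > 0" and generator: "discriminant_generator L B n x"
    and half_norm: "B x x / 2 - of_int c / of_nat n \<in> \<int>"
    and unit: "coprime u (int n)" "[a = c * u ^ 2] (mod int n)"
  shows "isometric (discriminant_module L B) (cyclic_qm n a)"
proof -
  have ux_mod_L: "of_int u *\<^sub>R x - of_int u *\<^sub>R x \<in> L" using even_lattice_zero[OF even] by simp
  have "discriminant_generator L B n (of_int u *\<^sub>R x)"
    by (rule discriminant_generator_unit_multiple[OF generator unit(1) ux_mod_L])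
  moreover have "B (of_int u *\<^sub>R x) (of_int u *\<^sub>R x) / 2 - of_int a / of_nat n \<in> \<int>"
  proof -
    obtain k where "c * u ^ 2 = a + int n * k" using unit(2) unfolding cong_iff_lin by blast
    then have "real_of_int c * of_int u ^ 2 = of_int a + of_nat n * of_int k"
      by (metis of_int_add of_int_mult of_int_of_nat_eq of_int_power)
    then have "of_int c / of_nat n * of_int u ^ 2 = of_int a / of_nat n + real_of_int k"
      using n_pos by (simp add: field_simps)
    then show ?thesis
      using Ints_add[OF generator_half_norm[OF _ half_norm ux_mod_L] Ints_of_int[of k]] generator
      unfolding discriminant_generator_def by (simp add: algebra_simps)
  qed
  ultimately show ?thesis unfolding isometric_cyclic_qm_iff[OF n_pos] by blast
qed

end

section \<open>Lattices given by Gram matrices\<close>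

lemma int_basis_std_lattice:
  "int_basis (range (\<lambda>i. axis i 1)) (std_lattice :: (real ^ 'n) set)"
proof -
  let ?e = "\<lambda>i. axis i (1::real) :: real ^ 'n"
  have inj: "inj ?e" by (auto simp: inj_def axis_eq_axis)
  have "range ?e = Basis" by (auto simp: Basis_vec_def)
  then have "independent (range ?e)" by (simp add: independent_Basis)
  moreover have "std_lattice = range (\<lambda>c. \<Sum>x\<in>range ?e. of_int (c x) *\<^sub>R x)"
  proof (intro Set.set_eqI iffI)
    fix x :: "real ^ 'n" assume "x \<in> std_lattice"
    then have floor: "real_of_int \<lfloor>x $ i\<rfloor> = x $ i" for i
      unfolding std_lattice_def by (auto elim: Ints_cases)
    have "(\<Sum>z\<in>range ?e. of_int \<lfloor>x \<bullet> z\<rfloor> *\<^sub>R z) = (\<Sum>i\<in>UNIV. x $ i *\<^sub>R ?e i)"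
      by (simp add: sum.reindex[OF inj] inner_axis floor)
    also have "\<dots> = x" by (simp add: vec_eq_iff axis_def if_distrib cong: if_cong)
    finally show "x \<in> range (\<lambda>c. \<Sum>x\<in>range ?e. of_int (c x) *\<^sub>R x)"
      by (intro range_eqI[where x = "\<lambda>z. \<lfloor>x \<bullet> z\<rfloor>"]) simp
  next
    fix x assume "x \<in> range (\<lambda>c. \<Sum>x\<in>range ?e. of_int (c x) *\<^sub>R x)"
    then obtain c where "x = (\<Sum>x\<in>range ?e. of_int (c x) *\<^sub>R x)" by blast
    then show "x \<in> std_lattice"
      unfolding std_lattice_def by (auto simp: axis_def intro!: Ints_sum Ints_mult)
  qed
  ultimately show ?thesis unfolding int_basis_def by simp
qed

lemma lattice_rank_std_lattice: "lattice_rank (std_lattice :: (real ^ 'n) set) = CARD('n)"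
  unfolding lattice_rank_eq_card[OF int_basis_std_lattice]
  by (rule card_image) (auto simp: inj_def axis_eq_axis)

lemma gram_det_range:
  fixes e :: "'n::finite \<Rightarrow> 'v"
  assumes inj: "inj e"
  shows "gram_det B (range e) = det (\<chi> i j. B (e i) (e j))"
proof -
  have e_bij: "bij_betw e UNIV (range e)" using inj by (simp add: bij_betw_def)
  have "map_permutation UNIV e = (\<lambda>\<pi> x. if x \<in> range e then e (\<pi> (inv_into UNIV e x)) else x)"
    by (simp add: fun_eq_iff map_permutation_def restrict_id_def)
  then have bij: "bij_betw (map_permutation UNIV e) {\<pi>. \<pi> permutes UNIV} {\<pi>. \<pi> permutes range e}"
    using bij_betw_permutations[OF e_bij] by simp
  have "gram_det B (range e) = (\<Sum>\<pi> | \<pi> permutes UNIV.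
      of_int (sign (map_permutation UNIV e \<pi>)) * (\<Prod>x\<in>range e. B x (map_permutation UNIV e \<pi> x)))"
    unfolding gram_det_def by (rule sum.reindex_bij_betw[OF bij, symmetric])
  also have "\<dots> = (\<Sum>\<pi> | \<pi> permutes UNIV. of_int (sign \<pi>) * (\<Prod>i\<in>UNIV. B (e i) (e (\<pi> i))))"
    using inj by (intro sum.cong refl)
      (simp add: sign_map_permutation prod.reindex map_permutation_apply)
  finally show ?thesis unfolding det_def by simp
qed

definition even_gram :: "real ^ 'n ^ 'n \<Rightarrow> bool" where
  "even_gram G \<longleftrightarrow> transpose G = G \<and> (\<forall>i j. G $ i $ j \<in> \<int>) \<and> (\<forall>i. G $ i $ i / 2 \<in> \<int>)"

lemma even_gram_sym: "even_gram G \<Longrightarrow> G $ i $ j = G $ j $ i"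
  unfolding even_gram_def transpose_def vec_eq_iff by simp

lemma bilinear_gram_form: "bilinear (gram_form G)"
  unfolding bilinear_def linear_iff gram_form_def
  by (simp add: inner_add_left inner_add_right matrix_vector_right_distrib
      matrix_vector_mult_scaleR)

lemma gram_form_commute:
  assumes "transpose G = G"
  shows "gram_form G x y = gram_form G y x"
  unfolding gram_form_def
  by (metis assms dot_lmul_matrix inner_commute transpose_matrix_vector)

lemma gram_form_axis: "gram_form G (axis i s) (axis j t) = s * G $ i $ j * t"
proof -
  have "(G *v axis j t) $ i = G $ i $ j * t"
    unfolding matrix_vector_mult_def by (simp add: axis_def if_distrib cong: if_cong)
  then show ?thesis unfolding gram_form_def by (simp add: inner_axis')
qed

lemma even_lattice_std_lattice:
  assumes "even_gram G"
  shows "even_lattice std_lattice (gram_form G)"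
proof (rule even_latticeI[OF int_basis_std_lattice bilinear_gram_form])
  show "gram_form G x y = gram_form G y x" for x y
    using assms gram_form_commute unfolding even_gram_def by blast
qed (use assms in \<open>auto simp: even_gram_def gram_form_axis\<close>)

lemma mem_dual_std_lattice_iff:
  fixes G :: "real ^ 'n ^ 'n"
  assumes "transpose G = G"
  shows "x \<in> dual_lattice std_lattice (gram_form G) \<longleftrightarrow> G *v x \<in> std_lattice"
proof -
  have "gram_form G x (axis i 1) = (G *v x) $ i" for i
    unfolding gram_form_commute[OF assms, of x] by (simp add: gram_form_def inner_axis')
  moreover have "span (range (\<lambda>i. axis i 1)) = (UNIV :: (real ^ 'n) set)"
  proof -
    have "range (\<lambda>i. axis i 1) = (Basis :: (real ^ 'n) set)" by (auto simp: Basis_vec_def)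
    then show ?thesis by simp
  qed
  ultimately show ?thesis
    unfolding mem_dual_lattice_iff[OF int_basis_std_lattice bilinear_gram_form]
    by (simp add: std_lattice_def)
qed

lemma nondegenerate_std_lattice:
  assumes "even_gram G" and "det G \<noteq> 0"
  shows "nondegenerate_lattice std_lattice (gram_form G)"
proof -
  have "gram_det (gram_form G) (range (\<lambda>i. axis i 1)) = det G"
    by (subst gram_det_range) (auto simp: inj_def axis_eq_axis gram_form_axis)
  then show ?thesis
    using even_lattice_std_lattice[OF assms(1)] int_basis_std_lattice assms(2)
    unfolding nondegenerate_lattice_def even_lattice_def by metis
qed

lemma det_Ints:
  fixes A :: "real ^ 'n ^ 'n"
  assumes "\<And>i j. A $ i $ j \<in> \<int>"
  shows "det A \<in> \<int>"
  unfolding det_def using assms by (intro Ints_sum Ints_mult Ints_prod) auto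

lemma unimodular_mult_mem_std_lattice_imp:
  fixes A :: "real ^ 'n ^ 'n"
  assumes int: "\<And>i j. A $ i $ j \<in> \<int>" and unit: "\<bar>det A\<bar> = 1" and image: "A *v x \<in> std_lattice"
  shows "x \<in> std_lattice"
proof -
  have "x $ k \<in> \<int>" for k
  proof -
    have "x $ k * det A \<in> \<int>"
      unfolding cramer_lemma[symmetric] using int image
      by (intro det_Ints) (simp add: std_lattice_def)
    then show ?thesis using unit Ints_minus by (auto simp: abs_if split: if_splits)
  qed
  then show ?thesis by (simp add: std_lattice_def)
qed

text \<open>Dividing the \<open>k\<close>-th column of \<open>G\<close> by \<open>n\<close> gives a unimodular matrix, which maps
  \<open>x\<close> with its \<open>k\<close>-th coordinate multiplied by \<open>n\<close> to \<open>G x\<close>.\<close>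

lemma mem_dual_std_lattice_imp_Ints:
  fixes G :: "real ^ 'n ^ 'n"
  assumes n_pos: "n > 0" and gram: "even_gram G" and det: "\<bar>det G\<bar> = real n"
    and row: "\<And>j. G $ k $ j / real n \<in> \<int>"
    and x_dual: "x \<in> dual_lattice std_lattice (gram_form G)"
  shows "real n * x $ k \<in> \<int>" and "i \<noteq> k \<Longrightarrow> x $ i \<in> \<int>"
proof -
  define A where "A = transpose (\<chi> i. if i = k then (1 / real n) *s G $ k else G $ i)"
  define y where "y = (\<chi> i. if i = k then real n * x $ k else x $ i)"
  have A_entry: "A $ i $ j = (if j = k then G $ i $ k / real n else G $ i $ j)" for i j
    unfolding A_def transpose_def by (simp add: even_gram_sym[OF gram, of i])
  have "(A *v y) $ i = (G *v x) $ i" for i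
    unfolding matrix_vector_mult_def using n_pos by (auto simp: A_entry y_def intro: sum.cong)
  then have "A *v y = G *v x" by (simp add: vec_eq_iff)
  then have "A *v y \<in> std_lattice"
    using x_dual gram by (simp add: mem_dual_std_lattice_iff even_gram_def)
  moreover have "\<bar>det A\<bar> = 1"
  proof -
    have "det A = 1 / real n * det (\<chi> i. if i = k then G $ k else G $ i)"
      unfolding A_def det_transpose by (rule det_row_mul)
    also have "(\<chi> i. if i = k then G $ k else G $ i) = G" by (simp add: vec_eq_iff)
    finally show ?thesis using det n_pos by (simp add: abs_mult)
  qed
  moreover have "A $ i $ j \<in> \<int>" for i j
    using row[of i] gram even_gram_sym[OF gram, of i] by (simp add: A_entry even_gram_def)
  ultimately have y_integral: "y \<in> std_lattice" using unimodular_mult_mem_std_lattice_imp by blast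
  then have "y $ k \<in> \<int>" "y $ i \<in> \<int>" unfolding std_lattice_def by simp_all
  then show "real n * x $ k \<in> \<int>" and "i \<noteq> k \<Longrightarrow> x $ i \<in> \<int>" unfolding y_def by simp_all
qed

lemma discriminant_generator_std_lattice:
  fixes G :: "real ^ 'n ^ 'n"
  assumes n_pos: "n > 0" and gram: "even_gram G" and det: "\<bar>det G\<bar> = real n"
    and row: "\<And>j. G $ k $ j / real n \<in> \<int>"
  shows "discriminant_generator std_lattice (gram_form G) n (axis k (1 / real n))"
proof -
  let ?x = "axis k (1 / real n) :: real ^ 'n" and ?D = "dual_lattice std_lattice (gram_form G)"
  have multiple: "(of_int m *\<^sub>R ?x) $ i = (if i = k then of_int m / real n else 0)" for m i
    by (simp add: axis_def)
  have "G *v ?x \<in> std_lattice"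
  proof -
    have "(G *v ?x) $ i = G $ k $ i / real n" for i
      unfolding matrix_vector_mult_def even_gram_sym[OF gram, of k]
      by (simp add: axis_def if_distrib cong: if_cong)
    then show ?thesis using row by (simp add: std_lattice_def)
  qed
  then have "?x \<in> ?D" using gram by (simp add: mem_dual_std_lattice_iff even_gram_def)
  moreover have "of_int m *\<^sub>R ?x \<in> std_lattice \<longleftrightarrow> int n dvd m" for m
  proof -
    have "of_int m *\<^sub>R ?x \<in> std_lattice \<longleftrightarrow> real_of_int m / real_of_int (int n) \<in> \<int>"
      unfolding std_lattice_def mem_Collect_eq multiple by (simp add: all_conj_distrib)
    also have "\<dots> \<longleftrightarrow> int n dvd m" using n_pos by (subst of_int_div_of_int_in_Ints_iff) simp
    finally show ?thesis .
  qed
  moreover have "\<exists>m::int. y - of_int m *\<^sub>R ?x \<in> std_lattice" if y_dual: "y \<in> ?D" for y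
  proof -
    obtain m :: int where "real n * y $ k = of_int m"
      using mem_dual_std_lattice_imp_Ints(1)[OF n_pos gram det row y_dual] by (rule Ints_cases)
    then have "(y - of_int m *\<^sub>R ?x) $ i \<in> \<int>" for i
      using mem_dual_std_lattice_imp_Ints(2)[OF n_pos gram det row y_dual, of i] n_pos
      unfolding vector_minus_component multiple by (cases "i = k") (simp_all add: field_simps)
    then show ?thesis unfolding std_lattice_def by blast
  qed
  ultimately show ?thesis unfolding discriminant_generator_def by blast
qed

lemma det_4:
  "det (A::'a::comm_ring_1^4^4) =
    A$1$1 * (A$2$2 * (A$3$3 * A$4$4 - A$3$4 * A$4$3) - A$2$3 * (A$3$2 * A$4$4 - A$3$4 * A$4$2)
      + A$2$4 * (A$3$2 * A$4$3 - A$3$3 * A$4$2))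
    - A$1$2 * (A$2$1 * (A$3$3 * A$4$4 - A$3$4 * A$4$3) - A$2$3 * (A$3$1 * A$4$4 - A$3$4 * A$4$1)
      + A$2$4 * (A$3$1 * A$4$3 - A$3$3 * A$4$1))
    + A$1$3 * (A$2$1 * (A$3$2 * A$4$4 - A$3$4 * A$4$2) - A$2$2 * (A$3$1 * A$4$4 - A$3$4 * A$4$1)
      + A$2$4 * (A$3$1 * A$4$2 - A$3$2 * A$4$1))
    - A$1$4 * (A$2$1 * (A$3$2 * A$4$3 - A$3$3 * A$4$2) - A$2$2 * (A$3$1 * A$4$3 - A$3$3 * A$4$1)
      + A$2$3 * (A$3$1 * A$4$2 - A$3$2 * A$4$1))"
proof -
  have insert_1: "finite {2::4, 3, 4}" "1 \<notin> {2::4, 3, 4}" by auto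
  have insert_2: "finite {3::4, 4}" "2 \<notin> {3::4, 4}" by auto
  have insert_3: "finite {4::4}" "3 \<notin> {4::4}" by auto
  show ?thesis
    unfolding det_def UNIV_4
    unfolding sum_over_permutations_insert[OF insert_1]
    unfolding sum_over_permutations_insert[OF insert_2]
    unfolding sum_over_permutations_insert[OF insert_3]
    unfolding permutes_sing
    by (simp add: sign_swap_id permutation_swap_id permutation_compose sign_compose sign_id
        swap_id_eq algebra_simps)
qed

lemma vector_4:
  "(vector [x, y, z, w] :: 'a::zero ^ 4) $ 1 = x"
  "(vector [x, y, z, w] :: 'a::zero ^ 4) $ 2 = y"
  "(vector [x, y, z, w] :: 'a::zero ^ 4) $ 3 = z"
  "(vector [x, y, z, w] :: 'a::zero ^ 4) $ 4 = w"
  unfolding vector_def by simp_all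

section \<open>Legendre symbols\<close>

lemma Legendre_eq_0_iff: "Legendre a p = 0 \<longleftrightarrow> p dvd a"
  unfolding Legendre_def by (simp add: cong_0_iff)

lemma Legendre_cong:
  assumes "[a = b] (mod p)"
  shows "Legendre a p = Legendre b p"
  using assms unfolding Legendre_def QuadRes_def cong_def by simp

lemma Legendre_square:
  assumes "prime p" and "\<not> p dvd a"
  shows "Legendre (a ^ 2) p = 1"
  using assms unfolding Legendre_def QuadRes_def
  by (auto simp: cong_0_iff prime_dvd_power_iff intro: exI[of _ a])

lemma Legendre_1: "prime p \<Longrightarrow> Legendre 1 p = 1"
  using Legendre_square[of p 1] by fastforce

lemma Legendre_eqI:
  assumes "prime p" and "odd p" and "\<epsilon> \<in> {- 1, 0, 1}" and "[\<epsilon> = a ^ ((p - 1) div 2)] (mod int p)"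
  shows "Legendre a (int p) = \<epsilon>"
proof -
  have p_gt_2: "2 < p" using assms(1,2) prime_ge_2_nat[of p] by (cases "p = 2") auto
  have "[Legendre a (int p) = \<epsilon>] (mod int p)"
    using euler_criterion[OF assms(1) p_gt_2] cong_sym[OF assms(4)] by (rule cong_trans)
  moreover have "\<bar>Legendre a (int p) - \<epsilon>\<bar> \<le> 2"
    using assms(3) unfolding Legendre_def by auto
  ultimately show ?thesis
    using p_gt_2 dvd_imp_le_int[of "Legendre a (int p) - \<epsilon>" "int p"]
    by (auto simp: cong_iff_dvd_diff)
qed

lemma Legendre_mult:
  assumes "prime p" and "odd p"
  shows "Legendre (a * b) (int p) = Legendre a (int p) * Legendre b (int p)"
proof (rule Legendre_eqI[OF assms])
  have p_gt_2: "2 < p" using assms prime_ge_2_nat[of p] by (cases "p = 2") auto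
  show "Legendre a (int p) * Legendre b (int p) \<in> {- 1, 0, 1}" unfolding Legendre_def by simp
  show "[Legendre a (int p) * Legendre b (int p) = (a * b) ^ ((p - 1) div 2)] (mod int p)"
    unfolding power_mult_distrib by (intro cong_mult euler_criterion[OF assms(1) p_gt_2])
qed

lemma Legendre_minus_1:
  assumes "prime p" and "odd p"
  shows "Legendre (- 1) (int p) = (if [p = 1] (mod 4) then 1 else - 1)"
proof -
  have "even ((p - 1) div 2) \<longleftrightarrow> [p = 1] (mod 4)"
    unfolding cong_def using assms(2) by presburger
  then show ?thesis using Legendre_eqI[OF assms, of "(- 1) ^ ((p - 1) div 2)"] by simp
qed

lemma QuadRes_prime_power:
  fixes p w :: int
  assumes odd_prime: "prime p" "odd p" and residue: "\<not> p dvd w" "QuadRes p w"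
  shows "QuadRes (p ^ Suc k) w"
proof (induction k)
  case 0
  then show ?case using residue(2) by simp
next
  case (Suc k)
  then obtain y where root: "[y ^ 2 = w] (mod p ^ Suc k)" unfolding QuadRes_def by blast
  then obtain m where root_square: "y ^ 2 = w + p ^ Suc k * m"
    using cong_sym[OF root] unfolding cong_iff_lin by blast
  have "\<not> p dvd y ^ 2" unfolding root_square using residue(1) by (simp add: dvd_add_left_iff)
  then have "\<not> p dvd 2 * y"
    using odd_prime prime_dvd_mult_iff[OF odd_prime(1)]
      primes_dvd_imp_eq[OF odd_prime(1) two_is_prime]
    by (auto simp: power2_eq_square)
  then have "coprime (2 * y) p" using odd_prime(1) prime_imp_coprime coprime_commute by blast
  then obtain z where "[2 * y * z = 1] (mod p)" using cong_solve_coprime_int by blast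
  then have "[2 * y * z * (- m) = 1 * (- m)] (mod p)" by (rule cong_scalar_right)
  then have "p dvd m + 2 * y * (- m * z)" by (simp add: cong_iff_dvd_diff algebra_simps)
  then obtain t where root_defect: "m + 2 * y * (- m * z) = p * t" by (elim dvdE)
  have "(y + p ^ Suc k * (- m * z)) ^ 2
      = w + p ^ Suc k * (m + 2 * y * (- m * z)) + p ^ Suc k * p ^ Suc k * (m * z) ^ 2"
    using root_square by (simp add: power2_eq_square algebra_simps)
  also have "\<dots> = w + p ^ Suc (Suc k) * (t + p ^ k * (m * z) ^ 2)"
    unfolding root_defect by (simp add: algebra_simps)
  finally have "[(y + p ^ Suc k * (- m * z)) ^ 2 = w] (mod p ^ Suc (Suc k))"
    by (simp add: cong_iff_dvd_diff)
  then show ?case unfolding QuadRes_def by blast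
qed

lemma Legendre_eq_imp_cong_square_multiple:
  fixes a c :: int
  assumes odd_prime: "prime p" "odd p" and r_pos: "r > 0" and a_unit: "\<not> int p dvd a"
    and Legendre_eq: "Legendre c (int p) = Legendre a (int p)"
  obtains s where "[a = c * s ^ 2] (mod int (p ^ r))" and "coprime s (int (p ^ r))"
proof -
  have c_unit: "\<not> int p dvd c" using a_unit Legendre_eq Legendre_eq_0_iff by metis
  have odd_prime_int: "prime (int p)" "odd (int p)" using odd_prime by simp_all
  have coprime: "coprime x (int p ^ r)" if "\<not> int p dvd x" for x
    using prime_imp_coprime[OF odd_prime_int(1) that] by (simp add: coprime_commute)
  obtain b where b_inverse: "[c * b = 1] (mod int p ^ r)"
    using cong_solve_coprime_int[OF coprime[OF c_unit]] by blast
  then have b_inverse_mod_p: "[c * b = 1] (mod int p)"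
    by (rule cong_dvd_modulus) (use r_pos in \<open>simp add: dvd_power\<close>)
  then have "Legendre c (int p) * Legendre b (int p) = 1"
    using Legendre_cong[OF b_inverse_mod_p] Legendre_mult[OF odd_prime]
      Legendre_1[OF odd_prime_int(1)] by simp
  then have "Legendre (a * b) (int p) = 1"
    unfolding Legendre_mult[OF odd_prime] Legendre_eq[symmetric] .
  then have "\<not> int p dvd a * b" "QuadRes (int p) (a * b)"
    unfolding Legendre_def by (auto simp: cong_0_iff split: if_splits)
  from QuadRes_prime_power[OF odd_prime_int this, of "r - 1"] r_pos
  obtain s where s_root: "[s ^ 2 = a * b] (mod int p ^ r)" unfolding QuadRes_def by auto
  have "[c * s ^ 2 = c * (a * b)] (mod int p ^ r)" by (rule cong_scalar_left[OF s_root])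
  also have "c * (a * b) = a * (c * b)" by simp
  also have "[a * (c * b) = a * 1] (mod int p ^ r)" by (rule cong_scalar_left[OF b_inverse])
  finally have cs_cong: "[c * s ^ 2 = a] (mod int p ^ r)" by simp
  then have "[c * s ^ 2 = a] (mod int p)"
    by (rule cong_dvd_modulus) (use r_pos in \<open>simp add: dvd_power\<close>)
  then have "\<not> int p dvd s" using a_unit cong_dvd_iff by (force simp: power2_eq_square)
  then show ?thesis using that cong_sym[OF cs_cong] coprime by simp
qed

section \<open>Values of binary forms of discriminant \<open>p\<^sup>r\<close>\<close>

lemma Legendre_eq_1_if_prime_divisors:
  fixes m :: int
  assumes odd_prime: "prime p" "odd p" and m_nonzero: "m \<noteq> 0"
    and minus_1: "Legendre (- 1) (int p) = 1"
    and primes: "\<And>l. prime l \<Longrightarrow> l dvd m \<Longrightarrow> Legendre l (int p) = 1"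
  shows "Legendre m (int p) = 1"
proof -
  have "x dvd m \<Longrightarrow> Legendre x (int p) = 1" for x
  proof (induction x rule: prime_divisors_induct)
    case zero
    then show ?case using m_nonzero by simp
  next
    case (unit x)
    then have "x = 1 \<or> x = - 1" by auto
    then show ?case using Legendre_1[of "int p"] odd_prime(1) minus_1 by auto
  next
    case (factor l x)
    then have "l dvd m" "x dvd m" by (blast intro: dvd_mult_left dvd_mult_right)+
    then show ?case using factor Legendre_mult[OF odd_prime, of l x] primes[of l] by simp
  qed
  then show ?thesis by simp
qed

text \<open>Modulo \<open>l\<close>, the odd power \<open>p\<^sup>r\<close> is a square, hence \<open>p\<close> is a square, and since \<open>p\<close> is
  congruent to 1 modulo 4, quadratic reciprocity makes \<open>l\<close> a square modulo \<open>p\<close>.\<close>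

lemma Legendre_prime_divisor_of_square_minus_odd_power:
  fixes h l :: int
  assumes prime_1_mod_4: "prime p" "[p = 1] (mod 4)" and r_odd: "odd r"
    and l_prime: "prime l" "odd l" "l \<noteq> int p" and l_dvd: "l dvd h ^ 2 - int p ^ r"
  shows "Legendre l (int p) = 1"
proof -
  have p_gt_2: "2 < p"
    using prime_1_mod_4 prime_ge_2_nat[of p] by (cases "p = 2") (auto simp: cong_def)
  have even_half: "even ((p - 1) div 2)" using prime_1_mod_4(2) unfolding cong_def by presburger
  obtain q where l_eq: "l = int q" using l_prime(1) prime_ge_0_int zero_le_imp_eq_int by metis
  have prime_q: "prime q" and odd_q: "odd q" and p_neq_q: "p \<noteq> q"
    using l_prime(1-3) unfolding l_eq by auto
  have q_gt_2: "2 < q" using prime_q odd_q prime_ge_2_nat[of q] by (cases "q = 2") auto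
  obtain k where r_eq: "r = Suc (2 * k)" using r_odd by (metis oddE Suc_eq_plus1)
  have ndvd: "\<not> int q dvd int p ^ j" for j
    using p_neq_q prime_q prime_1_mod_4(1) prime_dvd_power[of q p j] primes_dvd_imp_eq[of q p]
    by (auto simp flip: of_nat_power)
  have "QuadRes (int q) (int p ^ r)"
    using l_dvd unfolding l_eq QuadRes_def cong_iff_dvd_diff by blast
  then have "Legendre (int p ^ r) (int q) = 1"
    using ndvd[of r] unfolding Legendre_def by (simp add: cong_0_iff)
  moreover have "int p ^ r = int p * (int p ^ k) ^ 2"
    unfolding r_eq by (simp add: power_mult mult.commute)
  ultimately have "Legendre (int p) (int q) = 1"
    using Legendre_mult[OF prime_q odd_q] Legendre_square[OF _ ndvd, of k] prime_q by simp
  then show ?thesis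
    using Quadratic_Reciprocity[OF prime_1_mod_4(1) p_gt_2 prime_q q_gt_2 p_neq_q] even_half
    unfolding l_eq by simp
qed

lemma Legendre_odd_value:
  fixes m h g :: int
  assumes prime_1_mod_4: "prime p" "[p = 1] (mod 4)" and r_odd: "odd r"
    and m_odd_unit: "odd m" "\<not> int p dvd m" and disc: "h ^ 2 - 4 * m * g = int p ^ r"
  shows "Legendre m (int p) = 1"
proof (rule Legendre_eq_1_if_prime_divisors[OF prime_1_mod_4(1)])
  show odd: "odd p" using prime_1_mod_4(2) unfolding cong_def by presburger
  show "Legendre (- 1) (int p) = 1"
    using Legendre_minus_1[OF prime_1_mod_4(1) odd] prime_1_mod_4(2) by simp
  fix l :: int assume l_divisor: "prime l" "l dvd m"
  moreover have "odd l" "l \<noteq> int p" using l_divisor(2) m_odd_unit dvd_trans by auto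
  moreover have "l dvd h ^ 2 - int p ^ r" using l_divisor(2) by (simp flip: disc)
  ultimately show "Legendre l (int p) = 1"
    using Legendre_prime_divisor_of_square_minus_odd_power[OF prime_1_mod_4 r_odd] by blast
qed (use m_odd_unit in auto)

lemma prime_not_dvd_unimodular_coefficient:
  fixes p c v m :: int
  assumes "prime p" and "r > 0" and unit: "p ^ r * v ^ 2 - 4 * c * m = 1"
  shows "\<not> p dvd m"
proof
  assume "p dvd m"
  moreover have "p dvd p ^ r" using assms(2) by (simp add: dvd_power)
  ultimately have "p dvd p ^ r * v ^ 2 - 4 * c * m" by (intro dvd_diff) simp_all
  then show False using assms(1) unit by auto
qed

text \<open>The form with coefficients \<open>c p\<^sup>r\<close>, \<open>p\<^sup>r v\<close>, \<open>m\<close> has discriminant \<open>p\<^sup>r\<close>. If \<open>m\<close> is even, it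
  takes an odd value at \<open>(1, 1)\<close> or \<open>(1, 2)\<close>, and these are squares times \<open>m\<close> modulo \<open>p\<close>.\<close>

lemma Legendre_unimodular_last_coefficient:
  fixes c v m :: int
  assumes prime_1_mod_4: "prime p" "[p = 1] (mod 4)" and r_odd: "odd r"
    and unit: "int p ^ r * v ^ 2 - 4 * c * m = 1"
  shows "Legendre m (int p) = 1"
proof -
  define n where "n = int p ^ r"
  have odd_p: "odd p" using prime_1_mod_4(2) unfolding cong_def by presburger
  have prime_int_p: "prime (int p)" using prime_1_mod_4(1) by simp
  have p_dvd_n: "int p dvd n" using r_odd unfolding n_def by (simp add: dvd_power odd_pos)
  have n_v_square: "n * v ^ 2 = 1 + 4 * (c * m)" using unit unfolding n_def by simp
  have p_ndvd_m: "\<not> int p dvd m"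
    using prime_not_dvd_unimodular_coefficient[OF prime_int_p _ unit] r_odd by (simp add: odd_pos)
  show ?thesis
  proof (cases "odd m")
    case True
    have "(n * v) ^ 2 - 4 * m * (c * n) = n * (n * v ^ 2 - 4 * (c * m))"
      by (simp add: power2_eq_square algebra_simps)
    then show ?thesis
      using Legendre_odd_value[OF prime_1_mod_4 r_odd True p_ndvd_m] n_v_square unfolding n_def
      by simp
  next
    case False
    define y :: int where "y = (if even c then 1 else 2)"
    define w where "w = c * n + n * v * y + m * y ^ 2"
    have "odd n" using odd_p unfolding n_def by simp
    moreover have "odd (n * v ^ 2)" unfolding n_v_square by simp
    ultimately have "odd w" using False unfolding w_def y_def by auto
    have "\<not> int p dvd y"
      using prime_int_p odd_p primes_dvd_imp_eq[OF prime_int_p two_is_prime] unfolding y_def by auto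
    moreover have "[w = m * y ^ 2] (mod int p)"
      using p_dvd_n unfolding w_def by (simp add: cong_iff_dvd_diff)
    ultimately have Legendre_w: "Legendre w (int p) = Legendre m (int p)"
      using Legendre_cong Legendre_mult[OF prime_1_mod_4(1) odd_p] Legendre_square[OF prime_int_p]
      by simp
    have "(n * v + 2 * m * y) ^ 2 - 4 * w * m = n * (n * v ^ 2 - 4 * (c * m))"
      unfolding w_def by (simp add: power2_eq_square algebra_simps)
    then have "Legendre w (int p) = 1"
      using Legendre_odd_value[OF prime_1_mod_4 r_odd \<open>odd w\<close>] Legendre_w p_ndvd_m
        n_v_square Legendre_eq_0_iff
      unfolding n_def by (metis diff_add_cancel add_diff_cancel_right' mult.right_neutral)
    then show ?thesis using Legendre_w by simp
  qed
qed

lemma Legendre_unimodular_first_coefficient: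
  fixes c v m :: int
  assumes prime_1_mod_4: "prime p" "[p = 1] (mod 4)" and r_odd: "odd r"
    and unit: "int p ^ r * v ^ 2 - 4 * c * m = 1"
  shows "Legendre c (int p) = 1"
proof (rule Legendre_unimodular_last_coefficient[OF prime_1_mod_4 r_odd])
  show "int p ^ r * v ^ 2 - 4 * m * c = 1" using unit by (simp add: ac_simps)
qed

section \<open>Lattices of rank at most two\<close>

lemma generator_order_multiple_mem:
  assumes even: "even_lattice L B" and generator: "discriminant_generator L B n x"
    and v_dual: "v \<in> dual_lattice L B"
  shows "of_nat n *\<^sub>R v \<in> L"
proof -
  obtain m :: int where v_mod_L: "v - of_int m *\<^sub>R x \<in> L"
    using generator v_dual unfolding discriminant_generator_def by blast
  have "of_int (int n * m) *\<^sub>R x \<in> L"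
    using generator dvd_triv_left unfolding discriminant_generator_def by blast
  from even_lattice_closed(1)[OF even even_lattice_closed(4)[OF even v_mod_L, of "int n"] this]
  show ?thesis by (simp add: scaleR_diff_right)
qed

lemma double_mem_imp_mem:
  assumes even: "even_lattice L B" and generator: "discriminant_generator L B n x"
    and n_odd: "odd n" and v_dual: "v \<in> dual_lattice L B" and double: "2 *\<^sub>R v \<in> L"
  shows "v \<in> L"
proof -
  obtain k where n_eq: "n = 2 * k + 1" using n_odd by (rule oddE)
  have "of_nat n *\<^sub>R v - of_int (int k) *\<^sub>R 2 *\<^sub>R v \<in> L"
    by (intro even_lattice_closed(2,4)[OF even]
        generator_order_multiple_mem[OF even generator v_dual] double)
  moreover have "of_nat n *\<^sub>R v - of_int (int k) *\<^sub>R 2 *\<^sub>R v = v"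
    unfolding n_eq by (simp add: algebra_simps)
  ultimately show ?thesis by (simp only:)
qed

lemma lattice_rank_ge_2:
  assumes even: "even_lattice L B" and generator: "discriminant_generator L B n x"
    and order: "odd n" "n > 1"
  shows "2 \<le> lattice_rank L"
proof (rule ccontr)
  assume "\<not> 2 \<le> lattice_rank L"
  moreover obtain b where basis: "int_basis b L" using even_lattice_basis[OF even] .
  ultimately have "card b < 2" "finite b"
    using lattice_rank_eq_card[OF basis] unfolding int_basis_def by auto
  then consider (empty) "b = {}" | (singleton) e where "b = {e}"
    by (metis One_nat_def card_0_eq card_1_singletonE less_2_cases)
  then show False
  proof cases
    case empty
    have "x = 0"
      using generator int_basis_span[OF basis] empty
      unfolding discriminant_generator_def dual_lattice_def by simp
    then have "of_int 1 *\<^sub>R x \<in> L" using even_lattice_zero[OF even] by simp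
    then have "int n dvd 1" using generator unfolding discriminant_generator_def by blast
    then show False using order(2) by simp
  next
    case (singleton e)
    have e_mem: "e \<in> L" and e_nonzero: "e \<noteq> 0"
      using int_basis_subset[OF basis] basis unfolding singleton int_basis_def
      by (auto simp: dependent_single)
    have "(1 / 2) *\<^sub>R e \<in> dual_lattice L B"
      unfolding mem_dual_lattice_iff[OF basis even_lattice_bilinear[OF even]] singleton
      using even_lattice_half_norm[OF even e_mem]
      by (auto simp: even_lattice_form_simps[OF even] intro: span_scale span_base)
    then have "(1 / 2) *\<^sub>R e \<in> L"
      using double_mem_imp_mem[OF even generator order(1)] e_mem by simp
    then obtain k :: int where "(1 / 2) *\<^sub>R e = of_int k *\<^sub>R e"
      using basis unfolding singleton int_basis_def by auto
    then have "1 = 2 * real_of_int k" using e_nonzero by simp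
    then have "1 = 2 * k" by linarith
    then show False by presburger
  qed
qed

lemma int_basis_pair_iff:
  assumes "e \<noteq> f"
  shows "int_basis {e, f} L \<longleftrightarrow>
    independent {e, f} \<and> L = {of_int k *\<^sub>R e + of_int l *\<^sub>R f | k l. True}"
proof -
  have "range (\<lambda>c. \<Sum>x\<in>{e, f}. of_int (c x) *\<^sub>R x) = {of_int k *\<^sub>R e + of_int l *\<^sub>R f | k l. True}"
  proof (intro equalityI subsetI)
    fix x assume "x \<in> {of_int k *\<^sub>R e + of_int l *\<^sub>R f | k l. True}"
    then obtain k l where "x = of_int k *\<^sub>R e + of_int l *\<^sub>R f" by blast
    then show "x \<in> range (\<lambda>c. \<Sum>x\<in>{e, f}. of_int (c x) *\<^sub>R x)"
      using assms by (intro range_eqI[where x = "\<lambda>z. if z = e then k else l"]) simp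
  qed (use assms in auto)
  then show ?thesis unfolding int_basis_def by auto
qed

lemma int_basis_shear:
  fixes e f :: "'v::real_vector"
  assumes "int_basis {e, f} L" and "e \<noteq> f"
  shows "e + of_int t *\<^sub>R f \<noteq> f" and "int_basis {e + of_int t *\<^sub>R f, f} L"
proof -
  let ?e = "e + of_int t *\<^sub>R f"
  have indep: "independent {e, f}" and L_eq: "L = {of_int k *\<^sub>R e + of_int l *\<^sub>R f | k l. True}"
    using assms unfolding int_basis_pair_iff[OF assms(2)] by simp_all
  have "e \<notin> span {f}" using indep assms(2) by (simp add: independent_insert)
  then have not_span: "?e \<notin> span {f}"
    using span_diff[of ?e "{f}" "of_int t *\<^sub>R f"] span_base[of f "{f}"] span_scale by fastforce
  then show ne: "?e \<noteq> f" using span_base[of f "{f}"] by auto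
  have "independent {?e, f}"
    using not_span indep ne assms(2) by (simp add: independent_insert)
  moreover have "L = {of_int k *\<^sub>R ?e + of_int l *\<^sub>R f | k l. True}"
  proof (intro equalityI subsetI)
    fix x assume "x \<in> L"
    then obtain k l where "x = of_int k *\<^sub>R e + of_int l *\<^sub>R f" unfolding L_eq by blast
    then have "x = of_int k *\<^sub>R ?e + of_int (l - k * t) *\<^sub>R f" by (simp add: algebra_simps)
    then show "x \<in> {of_int k *\<^sub>R ?e + of_int l *\<^sub>R f | k l. True}" by blast
  next
    fix x assume "x \<in> {of_int k *\<^sub>R ?e + of_int l *\<^sub>R f | k l. True}"
    then obtain k l where "x = of_int k *\<^sub>R ?e + of_int l *\<^sub>R f" by blast
    then have "x = of_int k *\<^sub>R e + of_int (l + k * t) *\<^sub>R f" by (simp add: algebra_simps)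
    then show "x \<in> L" unfolding L_eq by blast
  qed
  ultimately show "int_basis {?e, f} L" unfolding int_basis_pair_iff[OF ne] by simp
qed

lemma gram_det_pair:
  assumes "e \<noteq> f"
  shows "gram_det B {e, f} = B e e * B f f - B e f * B f e"
proof -
  let ?g = "\<lambda>i::2. if i = 1 then e else f"
  have "{e, f} = range ?g" by (auto simp: UNIV_2)
  moreover have "inj ?g" using assms by (auto simp: inj_def forall_2)
  ultimately have "gram_det B {e, f} = det (\<chi> i j. B (?g i) (?g j))"
    using gram_det_range[of ?g B] by simp
  then show ?thesis by (simp add: det_2)
qed

lemma gram_det_shear:
  assumes "bilinear B" and "e \<noteq> f" and "e + t *\<^sub>R f \<noteq> f"
  shows "gram_det B {e + t *\<^sub>R f, f} = gram_det B {e, f}"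
  unfolding gram_det_pair[OF assms(2)] gram_det_pair[OF assms(3)]
  by (simp add: bilinear_ladd[OF assms(1)] bilinear_radd[OF assms(1)] bilinear_lmul[OF assms(1)]
      bilinear_rmul[OF assms(1)] algebra_simps)

lemma plane_vector_with_products:
  assumes "bilinear B" and "e \<noteq> f" and "gram_det B {e, f} \<noteq> 0"
  obtains y where "y \<in> span {e, f}" and "B y e = s" and "B y f = t"
proof
  define d where "d = gram_det B {e, f}"
  let ?y = "((s * B f f - t * B f e) / d) *\<^sub>R e + ((t * B e e - s * B e f) / d) *\<^sub>R f"
  show "?y \<in> span {e, f}" by (intro span_add span_scale span_base) auto
  have "B ?y e = s * d / d" "B ?y f = t * d / d"
    unfolding d_def gram_det_pair[OF assms(2)]
    by (simp_all add: bilinear_ladd[OF assms(1)] bilinear_lmul[OF assms(1)]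
        add_divide_distrib[symmetric] algebra_simps)
  then show "B ?y e = s" "B ?y f = t" using assms(3) unfolding d_def by simp_all
qed

lemma adapted_basis_of_unit_coordinate:
  assumes even: "even_lattice L B" and basis: "int_basis {e, f} L" "e \<noteq> f" "gram_det B {e, f} \<noteq> 0"
    and coords: "of_nat n *\<^sub>R x = of_int k *\<^sub>R e + of_int l *\<^sub>R f"
    and k_coprime: "coprime k (int n)"
  obtains e' u h where "int_basis {e', f} L" and "e' \<noteq> f" and "gram_det B {e', f} \<noteq> 0"
    and "coprime u (int n)" and "h \<in> L" and "e' = of_nat n *\<^sub>R (of_int u *\<^sub>R x + h)"
proof -
  obtain u where inverse: "[k * u = 1] (mod int n)" using k_coprime cong_solve_coprime_int by blast
  then obtain q where inverse_eq: "k * u = 1 + int n * q"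
    using cong_sym[OF inverse] unfolding cong_iff_lin by blast
  let ?e = "e + of_int (u * l) *\<^sub>R f"
  have "of_nat n *\<^sub>R (of_int u *\<^sub>R x + of_int (- q) *\<^sub>R e)
      = of_int u *\<^sub>R (of_nat n *\<^sub>R x) - of_int (int n * q) *\<^sub>R e"
    by (simp add: algebra_simps)
  also have "\<dots> = of_int (k * u - int n * q) *\<^sub>R e + of_int (u * l) *\<^sub>R f"
    unfolding coords by (simp add: algebra_simps)
  finally have "?e = of_nat n *\<^sub>R (of_int u *\<^sub>R x + of_int (- q) *\<^sub>R e)"
    unfolding inverse_eq by simp
  moreover have "of_int (- q) *\<^sub>R e \<in> L"
    using int_basis_subset[OF basis(1)] by (intro even_lattice_closed(4)[OF even]) simp
  moreover have "coprime u (int n)"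
    using inverse by (metis cong_imp_coprime cong_sym coprime_1_left coprime_mult_left_iff)
  moreover have "gram_det B {?e, f} \<noteq> 0"
    using gram_det_shear[OF even_lattice_bilinear[OF even] basis(2)
        int_basis_shear(1)[OF basis(1,2), of "u * l"]] basis(3)
    by simp
  ultimately show ?thesis using that int_basis_shear[OF basis(1,2)] by blast
qed

lemma generator_order_multiple_primitive:
  assumes generator: "discriminant_generator L B n x" and n_pos: "n > 0"
    and divisor: "d dvd n" "d > 1" and multiple: "of_nat n *\<^sub>R x = of_nat d *\<^sub>R z"
  shows "z \<notin> L"
proof
  assume "z \<in> L"
  obtain m where n_eq: "n = d * m" using divisor(1) by (elim dvdE)
  have "of_nat d *\<^sub>R z = of_nat d *\<^sub>R of_int (int m) *\<^sub>R x"
    using multiple unfolding n_eq by simp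
  then have "z = of_int (int m) *\<^sub>R x"
    by (rule scaleR_left_imp_eq[rotated]) (use divisor(2) in simp)
  then have "int n dvd int m"
    using \<open>z \<in> L\<close> generator unfolding discriminant_generator_def by blast
  then have "n dvd m" by (simp only: of_nat_dvd_iff)
  moreover have "0 < m" "m < n" using n_pos divisor(2) unfolding n_eq by simp_all
  ultimately show False by (simp only: nat_dvd_not_less)
qed

lemma cyclic_plane_adapted_basis:
  assumes even: "even_lattice L B"
    and basis: "int_basis b L" "card b = 2" "gram_det B b \<noteq> 0"
    and prime_p: "prime p" and r_pos: "r > 0" and generator: "discriminant_generator L B (p ^ r) x"
  obtains e f u h where "int_basis {e, f} L" and "e \<noteq> f" and "gram_det B {e, f} \<noteq> 0"
    and "coprime u (int (p ^ r))" and "h \<in> L" and "e = of_nat (p ^ r) *\<^sub>R (of_int u *\<^sub>R x + h)"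
proof -
  obtain e f where b_eq: "b = {e, f}" and "e \<noteq> f" using basis(2) by (auto simp: card_2_iff)
  have L_eq: "L = {of_int k *\<^sub>R e + of_int l *\<^sub>R f | k l. True}"
    using basis(1) unfolding b_eq int_basis_pair_iff[OF \<open>e \<noteq> f\<close>] by blast
  have n_pos: "p ^ r > 0" using prime_p prime_gt_0_nat by simp
  have "of_nat (p ^ r) *\<^sub>R x \<in> L"
    using generator generator_order_multiple_mem[OF even generator]
    unfolding discriminant_generator_def by blast
  then obtain k l where coords: "of_nat (p ^ r) *\<^sub>R x = of_int k *\<^sub>R e + of_int l *\<^sub>R f"
    unfolding L_eq by blast
  have "\<not> (int p dvd k \<and> int p dvd l)"
  proof
    assume "int p dvd k \<and> int p dvd l"
    then obtain k' l' where "k = int p * k'" "l = int p * l'" by (auto elim!: dvdE)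
    then have "of_nat (p ^ r) *\<^sub>R x = of_nat p *\<^sub>R (of_int k' *\<^sub>R e + of_int l' *\<^sub>R f)"
      unfolding coords by (simp add: scaleR_add_right)
    moreover have "p dvd p ^ r" "p > 1"
      using prime_p r_pos prime_gt_1_nat by (simp_all add: dvd_power)
    ultimately show False
      using generator_order_multiple_primitive[OF generator n_pos] unfolding L_eq by blast
  qed
  moreover have "coprime m (int (p ^ r))" if "\<not> int p dvd m" for m
    using prime_imp_coprime[of "int p" m] prime_p that by (simp add: coprime_commute)
  ultimately consider (fst) "coprime k (int (p ^ r))" | (snd) "coprime l (int (p ^ r))" by blast
  then show ?thesis
  proof cases
    case fst
    have basis': "int_basis {e, f} L" "gram_det B {e, f} \<noteq> 0"
      using basis unfolding b_eq by simp_all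
    show ?thesis
      by (rule adapted_basis_of_unit_coordinate[OF even basis'(1) \<open>e \<noteq> f\<close> basis'(2) coords fst])
        (rule that)
  next
    case snd
    have basis': "int_basis {f, e} L" "f \<noteq> e" "gram_det B {f, e} \<noteq> 0"
      using basis \<open>e \<noteq> f\<close> unfolding b_eq by (simp_all add: insert_commute)
    have coords': "of_nat (p ^ r) *\<^sub>R x = of_int l *\<^sub>R f + of_int k *\<^sub>R e"
      using coords by (simp add: add.commute)
    show ?thesis
      by (rule adapted_basis_of_unit_coordinate[OF even basis' coords' snd]) (rule that)
  qed
qed

lemma adapted_basis_pairing_onto:
  assumes even: "even_lattice L B" and basis: "int_basis {e, f} L" "e \<noteq> f" "gram_det B {e, f} \<noteq> 0"
    and generator: "discriminant_generator L B n g" and e_eq: "e = of_nat n *\<^sub>R g"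
  obtains i j :: int where "of_int i * B g e + of_int j * B f e = of_int s"
    and "of_int i * B g f + of_int j * B f f = of_int t"
proof -
  obtain y where y_products: "y \<in> span {e, f}" "B y e = of_int s" "B y f = of_int t"
    using plane_vector_with_products[OF even_lattice_bilinear[OF even] basis(2,3)] .
  then have "y \<in> dual_lattice L B"
    by (simp add: mem_dual_lattice_iff[OF basis(1) even_lattice_bilinear[OF even]])
  then obtain k :: int where "y - of_int k *\<^sub>R g \<in> L"
    using generator unfolding discriminant_generator_def by blast
  then obtain i j :: int where "y - of_int k *\<^sub>R g = of_int i *\<^sub>R e + of_int j *\<^sub>R f"
    using basis(1) unfolding int_basis_pair_iff[OF basis(2)] by blast
  then have "y = of_int (k + int n * i) *\<^sub>R g + of_int j *\<^sub>R f"
    unfolding e_eq by (simp add: algebra_simps)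
  then have "B y z = of_int (k + int n * i) * B g z + of_int j * B f z" for z
    by (simp add: even_lattice_form_simps[OF even])
  then show ?thesis using y_products(2,3) that by metis
qed

text \<open>The pairings of the basis \<open>e / n, f\<close> of the dual lattice with the basis \<open>e, f\<close> form an
  invertible integral matrix, since the dual lattice contains the dual basis of \<open>e, f\<close>.\<close>

lemma adapted_basis_unimodular:
  assumes even: "even_lattice L B" and basis: "int_basis {e, f} L" "e \<noteq> f" "gram_det B {e, f} \<noteq> 0"
    and n_odd: "odd n" and generator: "discriminant_generator L B n g"
    and e_eq: "e = of_nat n *\<^sub>R g"
  obtains c v m :: int where "B e e = 2 * of_int c * of_nat n"
    and "\<bar>int n * v ^ 2 - 4 * c * m\<bar> = 1"
proof -
  have basis_mem: "e \<in> L" "f \<in> L" using int_basis_subset[OF basis(1)] by auto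
  have g_dual: "g \<in> dual_lattice L B" using generator unfolding discriminant_generator_def by blast
  obtain w v :: int where g_e: "B g e = of_int w" and g_f: "B g f = of_int v"
    using g_dual basis_mem unfolding dual_lattice_def mem_Collect_eq by (metis Ints_cases)
  obtain k m :: int where "B e e / 2 = of_int k" "B f f / 2 = of_int m"
    using even_lattice_half_norm[OF even basis_mem(1)] even_lattice_half_norm[OF even basis_mem(2)]
    by (metis Ints_cases)
  then have e_e: "B e e = 2 * of_int k" and f_f: "B f f = 2 * of_int m" by simp_all
  have e_scale: "B e z = real n * B g z" for z
    unfolding e_eq by (simp add: even_lattice_form_simps[OF even])
  have f_e: "B f e = of_int (int n * v)"
    unfolding even_lattice_sym[OF even, of f e] e_scale g_f by simp
  have "real_of_int (int n * w) = of_int (2 * k)" using e_scale[of e] e_e g_e by simp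
  then have "int n * w = 2 * k" by (simp only: of_int_eq_iff)
  then have "even (int n * w)" by simp
  then obtain c where w_eq: "w = 2 * c" using n_odd by (auto elim: evenE)
  have pairing_onto: "\<exists>i j. 2 * c * i + int n * v * j = s \<and> v * i + 2 * m * j = t" for s t :: int
  proof -
    obtain i j :: int where "of_int i * B g e + of_int j * B f e = of_int s"
      "of_int i * B g f + of_int j * B f f = of_int t"
      using adapted_basis_pairing_onto[OF even basis generator e_eq] .
    then have "real_of_int (2 * c * i + int n * v * j) = of_int s"
      "real_of_int (v * i + 2 * m * j) = of_int t"
      unfolding g_e g_f f_e f_f w_eq by (simp_all add: ac_simps)
    then show ?thesis unfolding of_int_eq_iff by blast
  qed
  obtain i j where first_column: "2 * c * i + int n * v * j = 1" "v * i + 2 * m * j = 0"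
    using pairing_onto by blast
  obtain i' j' where second_column: "2 * c * i' + int n * v * j' = 0" "v * i' + 2 * m * j' = 1"
    using pairing_onto by blast
  have "(int n * v ^ 2 - 4 * c * m) * (i' * j - i * j')
      = (2 * c * i + int n * v * j) * (v * i' + 2 * m * j')
        - (2 * c * i' + int n * v * j') * (v * i + 2 * m * j)"
    by (simp add: power2_eq_square algebra_simps)
  also have "\<dots> = 1" unfolding first_column second_column by simp
  finally have "\<bar>int n * v ^ 2 - 4 * c * m\<bar> = 1" by (metis dvd_triv_left zdvd1_eq)
  moreover have "B e e = 2 * of_int c * of_nat n" using e_scale[of e] g_e w_eq by simp
  ultimately show ?thesis using that by blast
qed

lemma rank_2_cyclic_discriminant_coefficients:
  assumes even: "even_lattice L B" and nondeg: "nondegenerate_lattice L B"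
    and rank: "lattice_rank L = 2" and odd_prime: "prime p" "odd p" "r > 0"
    and iso: "isometric (discriminant_module L B) (cyclic_qm (p ^ r) a)"
  obtains c v m u :: int where "\<bar>int p ^ r * v ^ 2 - 4 * c * m\<bar> = 1"
    and "[c = a * u ^ 2] (mod int (p ^ r))" and "coprime u (int (p ^ r))"
proof -
  have n_pos: "p ^ r > 0" and n_nonzero: "real (p ^ r) \<noteq> 0"
    using odd_prime(1) prime_gt_0_nat by auto
  obtain b where gram_basis: "int_basis b L" "gram_det B b \<noteq> 0"
    using nondeg unfolding nondegenerate_lattice_def by blast
  have card: "card b = 2" using rank lattice_rank_eq_card[OF gram_basis(1)] by simp
  obtain x where generator: "discriminant_generator L B (p ^ r) x"
    and half_norm: "B x x / 2 - of_int a / of_nat (p ^ r) \<in> \<int>"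
    using iso unfolding isometric_cyclic_qm_iff[OF even n_pos] by blast
  obtain e f u h where adapted: "int_basis {e, f} L" "e \<noteq> f" "gram_det B {e, f} \<noteq> 0"
    and u_coprime: "coprime u (int (p ^ r))" and h_mem: "h \<in> L"
    and e_eq: "e = of_nat (p ^ r) *\<^sub>R (of_int u *\<^sub>R x + h)"
    using cyclic_plane_adapted_basis[OF even gram_basis(1) card gram_basis(2) odd_prime(1,3)
        generator] .
  define g where "g = of_int u *\<^sub>R x + h"
  have g_mod_L: "g - of_int u *\<^sub>R x \<in> L" using h_mem unfolding g_def by simp
  have g_generator: "discriminant_generator L B (p ^ r) g"
    by (rule discriminant_generator_unit_multiple[OF even generator u_coprime g_mod_L])
  obtain c v m where e_e: "B e e = 2 * of_int c * of_nat (p ^ r)"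
    and unit: "\<bar>int (p ^ r) * v ^ 2 - 4 * c * m\<bar> = 1"
    using adapted_basis_unimodular[OF even adapted _ g_generator e_eq[folded g_def]] odd_prime(2)
    by auto
  have "of_nat (p ^ r) * (of_nat (p ^ r) * B g g) = of_nat (p ^ r) * (2 * of_int c)"
    using e_e unfolding e_eq g_def[symmetric]
    by (simp add: even_lattice_form_simps[OF even] ac_simps)
  then have "of_nat (p ^ r) * B g g = 2 * of_int c"
    using n_nonzero by (simp only: mult_cancel_left simp_thms)
  then have "B g g / 2 = of_int c / of_nat (p ^ r)"
    using nonzero_eq_divide_eq[OF n_nonzero] by (simp add: ac_simps)
  moreover have "B g g / 2 - of_int a / of_nat (p ^ r) * of_int u ^ 2 \<in> \<int>"
    using generator_half_norm[OF even _ half_norm g_mod_L] generator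
    unfolding discriminant_generator_def by blast
  ultimately have "real_of_int (c - a * u ^ 2) / real_of_int (int (p ^ r)) \<in> \<int>"
    by (simp add: diff_divide_distrib)
  then have "int (p ^ r) dvd c - a * u ^ 2"
    using odd_prime(1) by (subst (asm) of_int_div_of_int_in_Ints_iff) auto
  then show ?thesis using that unit u_coprime by (simp add: cong_iff_dvd_diff)
qed

lemma Legendre_of_rank_2_cyclic_discriminant:
  assumes even: "even_lattice L B" and nondeg: "nondegenerate_lattice L B"
    and rank: "lattice_rank L = 2" and prime_1_mod_4: "prime p" "[p = 1] (mod 4)" and r_odd: "odd r"
    and iso: "isometric (discriminant_module L B) (cyclic_qm (p ^ r) a)"
  shows "Legendre a (int p) = 1"
proof -
  have odd_p: "odd p" using prime_1_mod_4(2) unfolding cong_def by presburger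
  have r_pos: "r > 0" using r_odd by (simp add: odd_pos)
  obtain c v m u where unit: "\<bar>int p ^ r * v ^ 2 - 4 * c * m\<bar> = 1"
    and c_cong: "[c = a * u ^ 2] (mod int (p ^ r))" and u_coprime: "coprime u (int (p ^ r))"
    using rank_2_cyclic_discriminant_coefficients[OF even nondeg rank prime_1_mod_4(1) odd_p
        r_pos iso] .
  have "[int p = 1] (mod 4)" using prime_1_mod_4(2) cong_int_iff[of p 1 4] by simp
  then have "[int p ^ r * v ^ 2 - 4 * c * m = 1 ^ r * v ^ 2 - 0] (mod 4)"
    by (intro cong_diff cong_mult cong_pow) (simp_all add: cong_0_iff)
  moreover have "v ^ 2 mod 4 \<noteq> 3"
  proof -
    have "v mod 4 \<in> {0, 1, 2, 3}" by auto
    moreover have "v ^ 2 mod 4 = (v mod 4) ^ 2 mod 4" by (simp add: power_mod)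
    ultimately show ?thesis by auto
  qed
  ultimately have "int p ^ r * v ^ 2 - 4 * c * m \<noteq> - 1" by (auto simp: cong_def)
  with unit have "int p ^ r * v ^ 2 - 4 * c * m = 1" by linarith
  then have "Legendre c (int p) = 1"
    by (rule Legendre_unimodular_first_coefficient[OF prime_1_mod_4 r_odd])
  moreover have "[c = a * u ^ 2] (mod int p)"
    using cong_dvd_modulus[OF c_cong, of "int p"] r_pos by (simp add: dvd_power)
  moreover have "\<not> int p dvd u"
    using u_coprime prime_1_mod_4(1) r_pos by (auto simp: coprime_absorb_right)
  ultimately show ?thesis
    using Legendre_cong[of c "a * u ^ 2"] Legendre_mult[OF prime_1_mod_4(1) odd_p]
      Legendre_square[of "int p" u] prime_1_mod_4(1)
    by simp
qed

section \<open>The explicit lattices\<close>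

definition has_cyclic_discriminant ::
    "'v::real_vector set \<Rightarrow> ('v \<Rightarrow> 'v \<Rightarrow> real) \<Rightarrow> nat \<Rightarrow> int \<Rightarrow> bool" where
  "has_cyclic_discriminant L B n a \<longleftrightarrow> even_lattice L B \<and> nondegenerate_lattice L B \<and>
     isometric (discriminant_module L B) (cyclic_qm n a)"

lemma has_cyclic_discriminant_conj:
  "even_lattice L B \<and> nondegenerate_lattice L B \<and>
     isometric (discriminant_module L B) (cyclic_qm n a) \<and> P \<longleftrightarrow>
   has_cyclic_discriminant L B n a \<and> P"
  "even_lattice L B \<and> nondegenerate_lattice L B \<and> P \<and>
     isometric (discriminant_module L B) (cyclic_qm n a) \<longleftrightarrow>
   has_cyclic_discriminant L B n a \<and> P"
  unfolding has_cyclic_discriminant_def by blast+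

lemma has_cyclic_discriminant_imp_rank_ge_2:
  assumes "has_cyclic_discriminant L B n a" and "odd n" and "n > 1"
  shows "2 \<le> lattice_rank L"
proof -
  have even: "even_lattice L B" and "isometric (discriminant_module L B) (cyclic_qm n a)"
    using assms(1) unfolding has_cyclic_discriminant_def by simp_all
  then obtain x where "discriminant_generator L B n x"
    using isometric_cyclic_qm_iff[OF even, of n a] assms(3) by auto
  then show ?thesis using lattice_rank_ge_2[OF even _ assms(2,3)] by blast
qed

lemma coprime_4_odd: "odd (q::nat) \<Longrightarrow> coprime 4 (int q)"
  using coprime_power_left_iff[of "2::int" 2 "int q"] by simp

lemma odd_square_cong_1_mod_4:
  fixes x :: int
  assumes "odd x"
  shows "[x ^ 2 = 1] (mod 4)"
proof -
  obtain t where "x = 2 * t + 1" using assms by (rule oddE)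
  then have "x ^ 2 - 1 = 4 * (t ^ 2 + t)" by (simp add: power2_eq_square algebra_simps)
  then show ?thesis by (simp add: cong_iff_dvd_diff)
qed

lemma cong_Legendre_minus_1_mod_4:
  assumes "prime p" and "odd p"
  shows "[int p = Legendre (- 1) (int p)] (mod 4)"
proof -
  have "p mod 4 = 1 \<or> p mod 4 = 3" using assms(2) by presburger
  then show ?thesis
    unfolding Legendre_minus_1[OF assms] by (auto simp: cong_def zmod_int[symmetric]) presburger+
qed

context
  fixes p r :: nat and a :: int
  assumes odd_prime: "prime p" "odd p" and r_pos: "r > 0" and a_unit: "\<not> int p dvd a"
begin

lemma has_cyclic_discriminant_std_lattice:
  fixes G :: "real ^ 'n ^ 'n" and c :: int
  assumes gram: "even_gram G" "\<bar>det G\<bar> = real p ^ r" "\<And>j. G $ k $ j / real p ^ r \<in> \<int>"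
    and diag: "G $ k $ k = 2 * of_int c * real p ^ r"
    and Legendre_eq: "Legendre c (int p) = Legendre a (int p)"
  shows "has_cyclic_discriminant std_lattice (gram_form G) (p ^ r) a"
proof -
  let ?x = "axis k (1 / real (p ^ r)) :: real ^ 'n"
  have p_pos: "p > 0" and n_pos: "p ^ r > 0" using odd_prime(1) prime_gt_0_nat by auto
  have even: "even_lattice std_lattice (gram_form G)" by (rule even_lattice_std_lattice[OF gram(1)])
  obtain s where s_unit: "coprime s (int (p ^ r))" "[a = c * s ^ 2] (mod int (p ^ r))"
    using Legendre_eq_imp_cong_square_multiple[OF odd_prime r_pos a_unit Legendre_eq] by metis
  have "discriminant_generator std_lattice (gram_form G) (p ^ r) ?x"
    by (rule discriminant_generator_std_lattice[OF n_pos gram(1)]) (use gram(2,3) in simp_all)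
  moreover have "gram_form G ?x ?x / 2 - of_int c / of_nat (p ^ r) \<in> \<int>"
    unfolding gram_form_axis diag using p_pos by (simp add: field_simps)
  ultimately have "isometric (discriminant_module std_lattice (gram_form G)) (cyclic_qm (p ^ r) a)"
    using s_unit by (rule isometric_cyclic_qm_square_multiple[OF even n_pos])
  moreover have "det G \<noteq> 0" using gram(2) p_pos by auto
  then have "nondegenerate_lattice std_lattice (gram_form G)"
    by (rule nondegenerate_std_lattice[OF gram(1)])
  ultimately show ?thesis unfolding has_cyclic_discriminant_def using even by simp
qed

lemma has_cyclic_discriminant_binary:
  fixes v m c :: int
  assumes unit: "\<bar>int p ^ r * v ^ 2 - 4 * c * m\<bar> = 1"
    and Legendre_eq: "Legendre c (int p) = Legendre a (int p)"
    and coeffs: "A = 2 * of_int c * real p ^ r" "B = real p ^ r * of_int v" "D = 2 * of_int m"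
  shows "has_cyclic_discriminant std_lattice
    (gram_form (vector [vector [A, B], vector [B, D]] :: real ^ 2 ^ 2)) (p ^ r) a"
proof (rule has_cyclic_discriminant_std_lattice[where k = 1 and c = c])
  let ?G = "vector [vector [A, B], vector [B, D]] :: real ^ 2 ^ 2"
  show "even_gram ?G"
    unfolding even_gram_def coeffs by (simp add: vec_eq_iff transpose_def forall_2)
  have "det ?G = of_int (- (int p ^ r * (int p ^ r * v ^ 2 - 4 * c * m)))"
    unfolding coeffs by (simp add: det_2 power2_eq_square algebra_simps)
  then have "\<bar>det ?G\<bar> = of_int \<bar>int p ^ r * (int p ^ r * v ^ 2 - 4 * c * m)\<bar>"
    by (simp only: of_int_abs abs_minus_cancel of_int_minus)
  then show "\<bar>det ?G\<bar> = real p ^ r" unfolding abs_mult unit by simp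
  have "\<forall>j. ?G $ 1 $ j / real p ^ r \<in> \<int>" unfolding forall_2 coeffs by simp
  then show "?G $ 1 $ j / real p ^ r \<in> \<int>" for j by blast
qed (simp_all add: coeffs Legendre_eq)

lemma has_cyclic_discriminant_quaternary:
  fixes v m c :: int
  assumes unit: "12 * c * m - 4 * c - 3 * (int p ^ r * v ^ 2) = 1"
    and Legendre_eq: "Legendre c (int p) = Legendre a (int p)"
    and coeffs: "A = 2 * of_int c * real p ^ r" "B = real p ^ r * of_int v" "D = 2 * of_int m"
  shows "has_cyclic_discriminant std_lattice
    (gram_form (vector [vector [A, B, 0, 0], vector [B, D, 1, 0], vector [0, 1, 2, 1],
      vector [0, 0, 1, 2]] :: real ^ 4 ^ 4)) (p ^ r) a"
proof (rule has_cyclic_discriminant_std_lattice[where k = 1 and c = c])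
  let ?G = "vector [vector [A, B, 0, 0], vector [B, D, 1, 0], vector [0, 1, 2, 1],
      vector [0, 0, 1, 2]] :: real ^ 4 ^ 4"
  show "even_gram ?G"
    unfolding even_gram_def coeffs by (simp add: vec_eq_iff transpose_def forall_4 vector_4)
  have "det ?G = of_int (int p ^ r * (12 * c * m - 4 * c - 3 * (int p ^ r * v ^ 2)))"
    unfolding coeffs by (simp add: det_4 vector_4 power2_eq_square algebra_simps)
  then show "\<bar>det ?G\<bar> = real p ^ r" unfolding unit by simp
  have "\<forall>j. ?G $ 1 $ j / real p ^ r \<in> \<int>" unfolding forall_4 coeffs by (simp add: vector_4)
  then show "?G $ 1 $ j / real p ^ r \<in> \<int>" for j by blast
qed (simp_all add: coeffs Legendre_eq vector_4)

lemma has_cyclic_discriminant_binary_residue: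
  assumes "Legendre a (int p) = 1"
  shows "has_cyclic_discriminant std_lattice (gram_form (vector
    [vector [2 * real p ^ r, real p ^ r],
     vector [real p ^ r, (real p ^ r - of_int (Legendre (- 1) (int p)) ^ r) / 2]] :: real ^ 2 ^ 2))
    (p ^ r) a"
proof -
  define \<epsilon> where "\<epsilon> = Legendre (- 1) (int p) ^ r"
  have "[int p ^ r = \<epsilon>] (mod 4)"
    unfolding \<epsilon>_def by (rule cong_pow[OF cong_Legendre_minus_1_mod_4[OF odd_prime]])
  then obtain m where m_eq: "int p ^ r - \<epsilon> = 4 * m" unfolding cong_iff_dvd_diff by (elim dvdE)
  have "\<bar>\<epsilon>\<bar> = 1" unfolding \<epsilon>_def Legendre_minus_1[OF odd_prime] by (simp add: power_abs)
  then have unit: "\<bar>int p ^ r * 1 ^ 2 - 4 * 1 * m\<bar> = 1" using m_eq by simp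
  have "(real p ^ r - of_int (Legendre (- 1) (int p)) ^ r) / 2 = 2 * of_int m"
    using arg_cong[OF m_eq, of real_of_int] unfolding \<epsilon>_def by simp
  then show ?thesis
    using has_cyclic_discriminant_binary[OF unit] assms Legendre_1[of "int p"] odd_prime(1) by simp
qed

lemma has_cyclic_discriminant_binary_nonresidue_even_power:
  fixes q :: nat and v :: int
  assumes "Legendre a (int p) = - 1" and r_even: "even r" and q_odd_prime: "prime q" "odd q"
    and q_nonresidue: "Legendre (int q) (int p) = - 1"
    and v_cong: "[int p ^ r * v ^ 2 = 1] (mod int q)" "[v ^ 2 = 1] (mod 4)"
  shows "has_cyclic_discriminant std_lattice (gram_form (vector
    [vector [2 * real q * real p ^ r, real p ^ r * of_int v],
     vector [real p ^ r * of_int v, (real p ^ r * of_int v ^ 2 - 1) / (2 * real q)]] :: real ^ 2 ^ 2))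
    (p ^ r) a"
proof -
  have "[int p ^ r = 1] (mod 4)"
    using r_even cong_pow[OF odd_square_cong_1_mod_4[of "int p"]] odd_prime(2)
    by (auto elim!: evenE simp: power_mult)
  then have "[int p ^ r * v ^ 2 = 1 * 1] (mod 4)" using v_cong(2) by (rule cong_mult)
  then have "[int p ^ r * v ^ 2 = 1] (mod 4 * int q)"
    using v_cong(1) coprime_4_odd[OF q_odd_prime(2)] coprime_cong_mult by auto
  then obtain m where m_eq: "int p ^ r * v ^ 2 - 1 = 4 * int q * m"
    unfolding cong_iff_dvd_diff by (elim dvdE)
  then have unit: "\<bar>int p ^ r * v ^ 2 - 4 * int q * m\<bar> = 1" by simp
  have "real p ^ r * of_int v ^ 2 - 1 = 4 * real q * of_int m"
    using arg_cong[OF m_eq, of real_of_int] by simp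
  then have "(real p ^ r * of_int v ^ 2 - 1) / (2 * real q) = 2 * of_int m"
    using prime_gt_0_nat[OF q_odd_prime(1)] by (simp add: field_simps)
  then show ?thesis
    using has_cyclic_discriminant_binary[OF unit] assms(1) q_nonresidue by simp
qed

lemma has_cyclic_discriminant_binary_nonresidue_odd_power:
  assumes "Legendre a (int p) = - 1" and r_odd: "odd r" and p_3_mod_4: "[p = 3] (mod 4)"
  shows "has_cyclic_discriminant std_lattice (gram_form (vector
    [vector [- 2 * real p ^ r, real p ^ r],
     vector [real p ^ r, - (real p ^ r + 1) / 2]] :: real ^ 2 ^ 2)) (p ^ r) a"
proof -
  have minus_1: "Legendre (- 1) (int p) = - 1"
    using p_3_mod_4 unfolding Legendre_minus_1[OF odd_prime] by (simp add: cong_def)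
  have "[int p ^ r = - 1] (mod 4)"
    using cong_pow[OF cong_Legendre_minus_1_mod_4[OF odd_prime], of r] r_odd unfolding minus_1
    by simp
  then obtain m where m_eq: "int p ^ r + 1 = 4 * m" unfolding cong_iff_dvd_diff by (auto elim: dvdE)
  then have unit: "\<bar>int p ^ r * 1 ^ 2 - 4 * (- 1) * (- m)\<bar> = 1" by simp
  have "- (real p ^ r + 1) / 2 = 2 * of_int (- m)"
    using arg_cong[OF m_eq, of real_of_int] by simp
  then show ?thesis
    using has_cyclic_discriminant_binary[OF unit] assms(1) minus_1 by simp
qed

lemma has_cyclic_discriminant_quaternary_nonresidue:
  fixes q :: nat and v :: int
  assumes "Legendre a (int p) = - 1" and p_1_mod_4: "[p = 1] (mod 4)"
    and q_prime: "prime q" "odd q" "[q = 2] (mod 3)"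
    and q_nonresidue: "Legendre (int q) (int p) = - 1"
    and v_cong: "[int p ^ r * v ^ 2 = - ((4 * int q + 1) div 3)] (mod int q)"
      "[v ^ 2 = - ((4 * int q + 1) div 3)] (mod 4)"
    and x_eq: "x = 1 / (4 * real q) * (real p ^ r * of_int v ^ 2 + (4 * real q + 1) / 3)"
  shows "has_cyclic_discriminant std_lattice (gram_form (vector
    [vector [2 * real q * real p ^ r, real p ^ r * of_int v, 0, 0],
     vector [real p ^ r * of_int v, 2 * x, 1, 0],
     vector [0, 1, 2, 1],
     vector [0, 0, 1, 2]] :: real ^ 4 ^ 4)) (p ^ r) a"
proof -
  define c where "c = (4 * int q + 1) div 3"
  have "3 dvd 4 * int q + 1"
    using q_prime(3) unfolding cong_def by presburger
  then have c_eq: "3 * c = 4 * int q + 1" unfolding c_def by simp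
  have "[int p = 1] (mod 4)" using p_1_mod_4 cong_int_iff[of p 1 4] by simp
  from cong_mult[OF cong_pow[OF this, of r] v_cong(2)]
  have "[int p ^ r * v ^ 2 = - c] (mod 4 * int q)"
    using v_cong(1) coprime_4_odd[OF q_prime(2)] coprime_cong_mult unfolding c_def by auto
  then obtain m where m_eq: "int p ^ r * v ^ 2 + c = 4 * int q * m"
    unfolding cong_iff_dvd_diff by (auto elim: dvdE)
  have unit: "12 * int q * m - 4 * int q - 3 * (int p ^ r * v ^ 2) = 1" using m_eq c_eq by simp
  have "real p ^ r * of_int v ^ 2 + of_int c = 4 * real q * of_int m"
    using arg_cong[OF m_eq, of real_of_int] by simp
  moreover have "(4 * real q + 1) / 3 = of_int c" using arg_cong[OF c_eq, of real_of_int] by simp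
  ultimately have "x = of_int m" using x_eq prime_gt_0_nat[OF q_prime(1)] by simp
  then show ?thesis
    using has_cyclic_discriminant_quaternary[OF unit] assms(1) q_nonresidue by simp
qed

end

theorem theorem4p2:
  fixes p r :: nat and a :: int
  assumes "prime p" and "odd p" and "r > 0" and "coprime (int p) a"
  shows
    "(Legendre a (int p) = 1 \<longrightarrow>
       (let L = (std_lattice :: (real ^ 2) set);
            B = gram_form (vector
                  [vector [2 * real p ^ r, real p ^ r],
                   vector [real p ^ r, (real p ^ r - of_int (Legendre (- 1) (int p)) ^ r) / 2]])
        in even_lattice L B \<and> nondegenerate_lattice L B
           \<and> isometric (discriminant_module L B) (cyclic_qm (p ^ r) a)
           \<and> \<not> (\<exists>(M :: 'v::real_vector set) C. even_lattice M C \<and> nondegenerate_lattice M C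
                  \<and> lattice_rank M < lattice_rank L
                  \<and> isometric (discriminant_module M C) (cyclic_qm (p ^ r) a))))
   \<and> (Legendre a (int p) = - 1 \<and> even r \<longrightarrow>
       (\<forall>(q::nat) (v::int). prime q \<and> odd q \<and> q \<noteq> p \<and> Legendre (int q) (int p) = - 1
          \<and> [int p ^ r * v ^ 2 = 1] (mod int q) \<and> [v ^ 2 = 1] (mod 4) \<longrightarrow>
       (let L = (std_lattice :: (real ^ 2) set);
            B = gram_form (vector
                  [vector [2 * real q * real p ^ r, real p ^ r * of_int v],
                   vector [real p ^ r * of_int v, (real p ^ r * of_int v ^ 2 - 1) / (2 * real q)]])
        in even_lattice L B \<and> nondegenerate_lattice L B
           \<and> isometric (discriminant_module L B) (cyclic_qm (p ^ r) a)
           \<and> \<not> (\<exists>(M :: 'v::real_vector set) C. even_lattice M C \<and> nondegenerate_lattice M C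
                  \<and> lattice_rank M < lattice_rank L
                  \<and> isometric (discriminant_module M C) (cyclic_qm (p ^ r) a)))))
   \<and> (Legendre a (int p) = - 1 \<and> odd r \<and> [p = 3] (mod 4) \<longrightarrow>
       (let L = (std_lattice :: (real ^ 2) set);
            B = gram_form (vector
                  [vector [- 2 * real p ^ r, real p ^ r],
                   vector [real p ^ r, - (real p ^ r + 1) / 2]])
        in even_lattice L B \<and> nondegenerate_lattice L B
           \<and> isometric (discriminant_module L B) (cyclic_qm (p ^ r) a)
           \<and> \<not> (\<exists>(M :: 'v::real_vector set) C. even_lattice M C \<and> nondegenerate_lattice M C
                  \<and> lattice_rank M < lattice_rank L
                  \<and> isometric (discriminant_module M C) (cyclic_qm (p ^ r) a))))
   \<and> (Legendre a (int p) = - 1 \<and> odd r \<and> [p = 1] (mod 4) \<longrightarrow>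
       \<not> (\<exists>(M :: 'v::real_vector set) C. even_lattice M C \<and> nondegenerate_lattice M C
             \<and> lattice_rank M \<in> {1, 2}
             \<and> isometric (discriminant_module M C) (cyclic_qm (p ^ r) a))
     \<and> (\<forall>(q::nat) (v::int) (x::real). prime q \<and> odd q \<and> [q = 2] (mod 3)
          \<and> Legendre (int q) (int p) = - 1
          \<and> [int p ^ r * v ^ 2 = - ((4 * int q + 1) div 3)] (mod int q)
          \<and> [v ^ 2 = - ((4 * int q + 1) div 3)] (mod 4)
          \<and> x = 1 / (4 * real q) * (real p ^ r * of_int v ^ 2 + (4 * real q + 1) / 3) \<longrightarrow>
       (let L = (std_lattice :: (real ^ 4) set);
            B = gram_form (vector
                  [vector [2 * real q * real p ^ r, real p ^ r * of_int v, 0, 0],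
                   vector [real p ^ r * of_int v, 2 * x, 1, 0],
                   vector [0, 1, 2, 1],
                   vector [0, 0, 1, 2]])
        in even_lattice L B \<and> nondegenerate_lattice L B \<and> lattice_rank L = 4
           \<and> isometric (discriminant_module L B) (cyclic_qm (p ^ r) a))))"
proof -
  have a_unit: "\<not> int p dvd a"
    using assms(1,4)
    by (metis coprime_common_divisor dvd_refl not_prime_unit prime_nat_int_transfer)
  have order: "odd (p ^ r)" "p ^ r > 1"
    using assms(2) one_less_power[OF prime_gt_1_nat[OF assms(1)] assms(3)] by simp_all
  have minimal: "\<not> lattice_rank M < 2" if "has_cyclic_discriminant M C (p ^ r) a"
    for M :: "'v set" and C
    using has_cyclic_discriminant_imp_rank_ge_2[OF that order] by simp
  have excluded: "lattice_rank M \<notin> {1, 2}" if "has_cyclic_discriminant M C (p ^ r) a"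
    "Legendre a (int p) = - 1" "odd r" "[p = 1] (mod 4)" for M :: "'v set" and C
    using minimal[OF that(1)] that(1,2)
      Legendre_of_rank_2_cyclic_discriminant[OF _ _ _ assms(1) that(4,3), of M C a]
    unfolding has_cyclic_discriminant_def by auto
  have rank: "lattice_rank (std_lattice :: (real ^ 2) set) = 2"
    "lattice_rank (std_lattice :: (real ^ 4) set) = 4"
    by (simp_all add: lattice_rank_std_lattice)
  note explicit = has_cyclic_discriminant_binary_residue
    has_cyclic_discriminant_binary_nonresidue_even_power
    has_cyclic_discriminant_binary_nonresidue_odd_power
    has_cyclic_discriminant_quaternary_nonresidue
  show ?thesis
    unfolding Let_def rank has_cyclic_discriminant_conj
    using minimal excluded explicit[OF assms(1-3) a_unit] by blast
qed

end
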